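(* Let $(T,\Sigma,\mu)$ be a non-atomic, $\sigma$-finite measure space and $\Phi$ a Musielak--Orlicz function on $T$. If the functional $f\in(L^\Phi)^*$ is purely singular, then $$\|f\|_0=\sup_{u\in L^\Phi}\frac{|f(u)|}{Q_\Phi(u)}\qquad\text{and}\qquad\|f\|=\sup_{u\in L^\Phi}\frac{|f(u)|}{Q_{\Phi,0}(u)},$$ or, equivalently, $$\|f\|_0=\|f\|=\sup_{u\in\tilde L^\Phi}|f(u)|=\sup_{u\in L^\Phi}\frac{|f(u)|}{\theta_\Phi(u)}.$$
   Context: A function $\Phi\colon T\times[0,\infty]\to[0,\infty]$ is a Musielak--Orlicz function if, for $\mu$-a.e. $t\in T$: (i) $\Phi(t,\cdot)$ is convex and lower semi-continuous; (ii) $\Phi(t,0)=\lim_{u\downarrow0}\Phi(t,u)=0$ and $\Phi(t,\infty)=\infty$; and (iii) $\Phi(\cdot,u)$ is measurable for all $u\ge0$. The complementary function is $\Phi^*(t,v)=\sup_{u>0}(uv-\Phi(t,u))$, $v\ge0$; it is again a Musielak--Orlicz function. $L^0$ is the space of real-valued measurable functions on $T$ (equality $\mu$-a.e.), $I_\Phi(u)=\int_T\Phi(t,|u(t)|)\,d\mu$, $L^\Phi=\{u\in L^0: I_\Phi(\lambda u)<\infty\text{ for some }\lambda>0\}$, $\tilde L^\Phi=\{u\in L^0:I_\Phi(u)<\infty\}$. The Luxemburg norm is $\|u\|_\Phi=\inf\{\lambda>0:I_\Phi(u/\lambda)\le1\}$ and the Orlicz norm is $\|u\|_{\Phi,0}=\sup\{|\int_T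 uv\,d\mu|: v\in\tilde L^{\Phi^*},\ I_{\Phi^*}(v)\le1\}$; these are equivalent norms making $L^\Phi$ a Banach space. $(L^\Phi)^*$ is its topological dual. For $f\in(L^\Phi)^*$, $\|f\|_0=\sup_{u\in L^\Phi\setminus\{0\}}|f(u)|/\|u\|_\Phi$ and $\|f\|=\sup_{u\in L^\Phi\setminus\{0\}}|f(u)|/\|u\|_{\Phi,0}$. For $u\in L^\Phi$: $\theta_\Phi(u)=\inf\{\lambda>0:I_\Phi(u/\lambda)<\infty\}$, $Q_\Phi(u)=\sup\{\inf_{n\ge1}\|u_n\|_\Phi:|u|\ge u_n\downarrow0\}$, and $Q_{\Phi,0}(u)=\sup\{\inf_{n\ge1}\|u_n\|_{\Phi,0}:|u|\ge u_n\downarrow0\}$, the suprema being over sequences of non-negative measurable functions $u_n\le|u|$ decreasing to $0$ $\mu$-a.e. In the quotients above, the convention $0/0=0$ is used. For $v\in L^{\Phi^*}$, $f_v(u)=\int_T uv\,d\mu$. Every $f\in(L^\Phi)^*$ decomposes uniquely as $f=f_{\mathrm c}+f_{\mathrm s}$, where $f_{\mathrm c}=f_v$ for some $v\in L^{\Phi^*}$ (order continuous component) and $f_{\mathrm s}$ is the singular component; $f$ is purely singular if $f_{\mathrm c}=0$. For a positive functional $f$ and $0\le u\in L^\Phi$, $f_{\mathrm c}(u)=\inf\{\sup_n f(u_n):0\le u_n\uparrow u\}$ and $f_{\mathrm s}(u)=\sup\{\inf_n f(u_n):u\ge u_n\downarrow0\}$; for general $f$ one uses the positive and negative parts. *)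

theory Defs
  imports "HOL-Analysis.Analysis"
begin

definition is_atom :: "'a measure \<Rightarrow> 'a set \<Rightarrow> bool" where
  "is_atom M A \<longleftrightarrow> A \<in> sets M \<and> emeasure M A > 0 \<and>
     (\<forall>B\<in>sets M. B \<subseteq> A \<longrightarrow> emeasure M B = 0 \<or> emeasure M (A - B) = 0)"

definition nonatomic :: "'a measure \<Rightarrow> bool" where
  "nonatomic M \<longleftrightarrow> (\<nexists>A. is_atom M A)"

text \<open>Extended nonnegative reals model \<open>[0, \<infinity>]\<close>, with \<open>0 * \<infinity> = 0\<close>.\<close>

definition convex_enn :: "(ennreal \<Rightarrow> ennreal) \<Rightarrow> bool" where
  "convex_enn \<phi> \<longleftrightarrow> (\<forall>a b u v. a + b = 1 \<longrightarrow> \<phi> (a * u + b * v) \<le> a * \<phi> u + b * \<phi> v)"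

text \<open>Lower semicontinuity includes the point \<open>\<infinity>\<close>; together with \<open>\<phi> \<infinity> = \<infinity>\<close> it forces
  \<open>\<phi> u\<close> to tend to \<open>\<infinity>\<close> as \<open>u\<close> does.\<close>

definition lower_semicont :: "('b::topological_space \<Rightarrow> 'c::linorder) \<Rightarrow> bool" where
  "lower_semicont \<phi> \<longleftrightarrow> (\<forall>u. \<forall>c < \<phi> u. eventually (\<lambda>w. c < \<phi> w) (nhds u))"

definition musielak_orlicz :: "'a measure \<Rightarrow> ('a \<Rightarrow> ennreal \<Rightarrow> ennreal) \<Rightarrow> bool" where
  "musielak_orlicz M \<Phi> \<longleftrightarrow>
     (AE t in M. convex_enn (\<Phi> t) \<and> lower_semicont (\<Phi> t) \<and>
        \<Phi> t 0 = 0 \<and> (\<Phi> t \<longlongrightarrow> 0) (at_right 0) \<and> \<Phi> t \<infinity> = \<infinity>) \<and>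
     (\<forall>u. (\<lambda>t. \<Phi> t u) \<in> borel_measurable M)"

text \<open>The supremum is over finite \<open>u\<close>. Subtraction on \<^typ>\<open>ennreal\<close> truncates at \<open>0\<close>, which does
  not change the supremum when \<open>\<Phi> t u\<close> tends to \<open>0\<close> as \<open>u\<close> decreases to \<open>0\<close>.\<close>

definition complementary :: "('a \<Rightarrow> ennreal \<Rightarrow> ennreal) \<Rightarrow> 'a \<Rightarrow> ennreal \<Rightarrow> ennreal" where
  "complementary \<Phi> t v = (SUP u\<in>{0<..<\<infinity>}. u * v - \<Phi> t u)"

definition modular :: "'a measure \<Rightarrow> ('a \<Rightarrow> ennreal \<Rightarrow> ennreal) \<Rightarrow> ('a \<Rightarrow> real) \<Rightarrow> ennreal" where
  "modular M \<Phi> u = (\<integral>\<^sup>+ t. \<Phi> t (ennreal \<bar>u t\<bar>) \<partial>M)"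

text \<open>Functions are not identified almost everywhere; every notion below is invariant under
  equality almost everywhere. In particular a functional that is linear and bounded with respect
  to the Luxemburg seminorm takes equal values on functions that agree almost everywhere.\<close>

definition orlicz_space :: "'a measure \<Rightarrow> ('a \<Rightarrow> ennreal \<Rightarrow> ennreal) \<Rightarrow> ('a \<Rightarrow> real) set" where
  "orlicz_space M \<Phi> = {u \<in> borel_measurable M. \<exists>l>0. modular M \<Phi> (\<lambda>t. l * u t) < \<infinity>}"

definition orlicz_class :: "'a measure \<Rightarrow> ('a \<Rightarrow> ennreal \<Rightarrow> ennreal) \<Rightarrow> ('a \<Rightarrow> real) set" where
  "orlicz_class M \<Phi> = {u \<in> borel_measurable M. modular M \<Phi> u < \<infinity>}"

text \<open>The norms and the functionals derived from them take values in \<^typ>\<open>ennreal\<close>; they are finite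
  on the Orlicz space.\<close>

definition luxemburg_norm :: "'a measure \<Rightarrow> ('a \<Rightarrow> ennreal \<Rightarrow> ennreal) \<Rightarrow> ('a \<Rightarrow> real) \<Rightarrow> ennreal" where
  "luxemburg_norm M \<Phi> u =
     (INF l\<in>{l. 0 < l \<and> modular M \<Phi> (\<lambda>t. u t / l) \<le> 1}. ennreal l)"

definition orlicz_norm :: "'a measure \<Rightarrow> ('a \<Rightarrow> ennreal \<Rightarrow> ennreal) \<Rightarrow> ('a \<Rightarrow> real) \<Rightarrow> ennreal" where
  "orlicz_norm M \<Phi> u =
     (SUP v\<in>{v \<in> orlicz_class M (complementary \<Phi>). modular M (complementary \<Phi>) v \<le> 1}.
        ennreal \<bar>LINT t|M. u t * v t\<bar>)"

definition theta :: "'a measure \<Rightarrow> ('a \<Rightarrow> ennreal \<Rightarrow> ennreal) \<Rightarrow> ('a \<Rightarrow> real) \<Rightarrow> ennreal" where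
  "theta M \<Phi> u = (INF l\<in>{l. 0 < l \<and> modular M \<Phi> (\<lambda>t. u t / l) < \<infinity>}. ennreal l)"

definition null_seqs :: "'a measure \<Rightarrow> ('a \<Rightarrow> real) \<Rightarrow> (nat \<Rightarrow> 'a \<Rightarrow> real) set" where
  "null_seqs M u = {us. (\<forall>n. us n \<in> borel_measurable M) \<and>
     (AE t in M. (\<forall>n. 0 \<le> us n t \<and> us n t \<le> \<bar>u t\<bar>) \<and>
        decseq (\<lambda>n. us n t) \<and> (\<lambda>n. us n t) \<longlonglongrightarrow> 0)}"

definition Q_lux :: "'a measure \<Rightarrow> ('a \<Rightarrow> ennreal \<Rightarrow> ennreal) \<Rightarrow> ('a \<Rightarrow> real) \<Rightarrow> ennreal" where
  "Q_lux M \<Phi> u = (SUP us\<in>null_seqs M u. INF n. luxemburg_norm M \<Phi> (us n))"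

definition Q_orl :: "'a measure \<Rightarrow> ('a \<Rightarrow> ennreal \<Rightarrow> ennreal) \<Rightarrow> ('a \<Rightarrow> real) \<Rightarrow> ennreal" where
  "Q_orl M \<Phi> u = (SUP us\<in>null_seqs M u. INF n. orlicz_norm M \<Phi> (us n))"

definition orlicz_dual ::
  "'a measure \<Rightarrow> ('a \<Rightarrow> ennreal \<Rightarrow> ennreal) \<Rightarrow> (('a \<Rightarrow> real) \<Rightarrow> real) set" where
  "orlicz_dual M \<Phi> = {f.
     (\<forall>u\<in>orlicz_space M \<Phi>. \<forall>v\<in>orlicz_space M \<Phi>. f (\<lambda>t. u t + v t) = f u + f v) \<and>
     (\<forall>c. \<forall>u\<in>orlicz_space M \<Phi>. f (\<lambda>t. c * u t) = c * f u) \<and>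
     (\<exists>C::real. \<forall>u\<in>orlicz_space M \<Phi>. ennreal \<bar>f u\<bar> \<le> ennreal C * luxemburg_norm M \<Phi> u)}"

text \<open>Division on \<^typ>\<open>ennreal\<close> satisfies \<open>0 / 0 = 0\<close>, and \<open>c / 0 = \<infinity>\<close> for \<open>c > 0\<close>.\<close>

definition sup_quotient ::
  "('a \<Rightarrow> real) set \<Rightarrow> (('a \<Rightarrow> real) \<Rightarrow> real) \<Rightarrow> (('a \<Rightarrow> real) \<Rightarrow> ennreal) \<Rightarrow> ennreal" where
  "sup_quotient S f q = (SUP u\<in>S. ennreal \<bar>f u\<bar> / q u)"

definition nonzero_orlicz :: "'a measure \<Rightarrow> ('a \<Rightarrow> ennreal \<Rightarrow> ennreal) \<Rightarrow> ('a \<Rightarrow> real) set" where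
  "nonzero_orlicz M \<Phi> = {u \<in> orlicz_space M \<Phi>. \<not> (AE t in M. u t = 0)}"

text \<open>The convention is crossed: the dual norm \<open>\<parallel>f\<parallel>\<^sub>0\<close> belongs to the Luxemburg norm
  \<open>\<parallel>u\<parallel>\<close>, and \<open>\<parallel>f\<parallel>\<close> to the Orlicz norm \<open>\<parallel>u\<parallel>\<^sub>0\<close>.\<close>

definition dual_norm0 ::
  "'a measure \<Rightarrow> ('a \<Rightarrow> ennreal \<Rightarrow> ennreal) \<Rightarrow> (('a \<Rightarrow> real) \<Rightarrow> real) \<Rightarrow> ennreal" where
  "dual_norm0 M \<Phi> f = sup_quotient (nonzero_orlicz M \<Phi>) f (luxemburg_norm M \<Phi>)"

definition dual_norm ::
  "'a measure \<Rightarrow> ('a \<Rightarrow> ennreal \<Rightarrow> ennreal) \<Rightarrow> (('a \<Rightarrow> real) \<Rightarrow> real) \<Rightarrow> ennreal" where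
  "dual_norm M \<Phi> f = sup_quotient (nonzero_orlicz M \<Phi>) f (orlicz_norm M \<Phi>)"

text \<open>The positive part of a functional in the order dual (Riesz--Kantorovich), as a function on
  the positive cone; the negative part of \<open>f\<close> is the positive part of \<open>-f\<close>.\<close>

definition functional_pos ::
  "'a measure \<Rightarrow> ('a \<Rightarrow> ennreal \<Rightarrow> ennreal) \<Rightarrow> (('a \<Rightarrow> real) \<Rightarrow> real) \<Rightarrow> ('a \<Rightarrow> real) \<Rightarrow> real" where
  "functional_pos M \<Phi> f u =
     (SUP w\<in>{w \<in> orlicz_space M \<Phi>. AE t in M. 0 \<le> w t \<and> w t \<le> u t}. f w)"

definition functional_neg ::
  "'a measure \<Rightarrow> ('a \<Rightarrow> ennreal \<Rightarrow> ennreal) \<Rightarrow> (('a \<Rightarrow> real) \<Rightarrow> real) \<Rightarrow> ('a \<Rightarrow> real) \<Rightarrow> real" where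
  "functional_neg M \<Phi> f = functional_pos M \<Phi> (\<lambda>w. - f w)"

definition increasing_seqs :: "'a measure \<Rightarrow> ('a \<Rightarrow> real) \<Rightarrow> (nat \<Rightarrow> 'a \<Rightarrow> real) set" where
  "increasing_seqs M u = {us. (\<forall>n. us n \<in> borel_measurable M) \<and>
     (AE t in M. (\<forall>n. 0 \<le> us n t) \<and> incseq (\<lambda>n. us n t) \<and> (\<lambda>n. us n t) \<longlonglongrightarrow> u t)}"

text \<open>For a positive functional \<open>g\<close> and \<open>u \<ge> 0\<close>.\<close>

definition oc_component_pos ::
  "'a measure \<Rightarrow> (('a \<Rightarrow> real) \<Rightarrow> real) \<Rightarrow> ('a \<Rightarrow> real) \<Rightarrow> real" where
  "oc_component_pos M g u = (INF us\<in>increasing_seqs M u. SUP n. g (us n))"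

text \<open>The order continuous component, extended from positive \<open>f\<close> and \<open>u\<close> by linearity in both.\<close>

definition oc_component ::
  "'a measure \<Rightarrow> ('a \<Rightarrow> ennreal \<Rightarrow> ennreal) \<Rightarrow> (('a \<Rightarrow> real) \<Rightarrow> real) \<Rightarrow> ('a \<Rightarrow> real) \<Rightarrow> real" where
  "oc_component M \<Phi> f u =
     (let c = (\<lambda>w. oc_component_pos M (functional_pos M \<Phi> f) w
                    - oc_component_pos M (functional_neg M \<Phi> f) w)
      in c (\<lambda>t. max (u t) 0) - c (\<lambda>t. max (- u t) 0))"

definition purely_singular ::
  "'a measure \<Rightarrow> ('a \<Rightarrow> ennreal \<Rightarrow> ennreal) \<Rightarrow> (('a \<Rightarrow> real) \<Rightarrow> real) \<Rightarrow> bool" where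
  "purely_singular M \<Phi> f \<longleftrightarrow> (\<forall>u\<in>orlicz_space M \<Phi>. oc_component M \<Phi> f u = 0)"

end

theory Submission
  imports Defs
begin

text \<open>If \<open>I(u/\<lambda>) < \<infinity>\<close> and \<open>|u| \<ge> u\<^sub>n \<down> 0\<close>, then \<open>I(u\<^sub>n/\<lambda>) \<rightarrow> 0\<close> by dominated convergence; since
  \<open>\<parallel>w\<parallel> \<le> \<lambda>\<close> once \<open>I(w/\<lambda>) \<le> 1\<close> and \<open>\<parallel>w\<parallel>\<^sub>0 \<le> \<lambda> (I(w/\<lambda>) + 1)\<close>, both \<open>Q(u)\<close> and \<open>Q\<^sub>0(u)\<close> are at
  most \<open>\<theta>(u)\<close>. Conversely \<open>\<theta>(u)\<close> is at most either norm of \<open>u\<close>, which for the Orlicz norm is a duality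
  argument. Hence each dual norm is at most \<open>sup |f|/\<theta>\<close>, which is at most \<open>sup |f|/Q\<close> and
  \<open>sup |f|/Q\<^sub>0\<close>. Singularity closes both cycles: there are \<open>y\<^sub>n \<up> |u|\<close> such that \<open>|f|\<close> is at most
  \<open>\<epsilon>\<close> on all \<open>z\<close> with \<open>|z| \<le> y\<^sub>n\<close>, so up to \<open>\<epsilon>\<close> the value \<open>f u\<close> is attained at
  \<open>sgn u (|u| - y\<^sub>n)\<close>, and \<open>|u| - y\<^sub>n\<close> is one of the sequences in the definition of \<open>Q(u)\<close>.\<close>

subsection \<open>Modulars and norms\<close>

text \<open>The axioms hold at every \<open>t\<close>, not just almost everywhere, so that pointwise
  arguments carry no exceptional set; \<open>regular_version\<close> supplies such an integrand.
  Measurability is required only for each fixed \<open>u\<close>; that of compositions is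
  derived.\<close>

locale regular_musielak_orlicz = sigma_finite_measure M
  for M :: "'a measure" +
  fixes \<Phi> :: "'a \<Rightarrow> ennreal \<Rightarrow> ennreal"
  assumes convex: "convex_enn (\<Phi> t)"
    and lsc: "lower_semicont (\<Phi> t)"
    and at_zero [simp]: "\<Phi> t 0 = 0"
    and tendsto_zero: "(\<Phi> t \<longlongrightarrow> 0) (at_right 0)"
    and at_infinity [simp]: "\<Phi> t top = top"
    and measurable_section: "(\<lambda>t. \<Phi> t u) \<in> borel_measurable M"
begin

section \<open>Pointwise consequences of convexity and lower semicontinuity\<close>

lemma convexD: "a + b = 1 \<Longrightarrow> \<Phi> t (a * u + b * v) \<le> a * \<Phi> t u + b * \<Phi> t v"
  using convex[of t] unfolding convex_enn_def by blast

lemma scale_le: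
  assumes "a \<le> 1"
  shows "\<Phi> t (a * u) \<le> a * \<Phi> t u"
  using convexD[of a "1 - a" t u 0] assms by (simp add: add_diff_inverse_ennreal)

text \<open>Monotonicity follows from convexity and the value 0 at 0: \<open>x\<close> is the convex
  combination of \<open>y\<close> and \<open>0\<close> with weight \<open>x / y\<close>. The cases
  where this quotient is useless, \<open>y = 0\<close> and \<open>y = top\<close>, are
  immediate.\<close>

lemma mono_arg:
  assumes "x \<le> y"
  shows "\<Phi> t x \<le> \<Phi> t y"
proof (cases "y = 0 \<or> y = top")
  case True
  then show ?thesis using assms by auto
next
  case False
  then have y: "y \<noteq> 0" "y < top" by (auto simp: less_top)
  have 1: "x / y \<le> 1"
    using assms y by (simp add: divide_le_posI_ennreal zero_less_iff_neq_zero)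
  have "x = (x / y) * y"
    using y by (simp add: ennreal_divide_times)
  then have "\<Phi> t x = \<Phi> t ((x / y) * y)" by simp
  also have "\<dots> \<le> (x / y) * \<Phi> t y" by (rule scale_le[OF 1])
  also have "\<dots> \<le> 1 * \<Phi> t y" by (intro mult_right_mono 1) auto
  finally show ?thesis by simp
qed

text \<open>Monotonicity and lower semicontinuity together give left continuity. Writing the value
  as a countable supremum is what makes compositions with measurable functions measurable. Negative
  rationals only contribute \<open>\<Phi> t 0 = 0\<close>.\<close>

lemma left_approx:
  assumes "0 < x"
  shows "\<Phi> t (ennreal x) = (SUP q::rat. if of_rat q < x then \<Phi> t (ennreal (of_rat q)) else 0)"
proof (rule antisym)
  show "\<Phi> t (ennreal x) \<le> (SUP q::rat. if of_rat q < x then \<Phi> t (ennreal (of_rat q)) else 0)"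
  proof (rule le_SUP_iff[THEN iffD2], intro allI impI)
    fix c assume c: "c < \<Phi> t (ennreal x)"
    then have "eventually (\<lambda>w. c < \<Phi> t w) (nhds (ennreal x))"
      using lsc[of t] unfolding lower_semicont_def by blast
    moreover have "filterlim ennreal (nhds (ennreal x)) (at_left x)"
      by (intro tendsto_ennrealI tendsto_ident_at)
    ultimately have "eventually (\<lambda>w. c < \<Phi> t (ennreal w)) (at_left x)"
      by (auto simp: filterlim_iff)
    then obtain b where b: "b < x" "\<And>w. b < w \<Longrightarrow> w < x \<Longrightarrow> c < \<Phi> t (ennreal w)"
      unfolding eventually_at_left_field by blast
    obtain q where "b < of_rat q" "of_rat q < x" using of_rat_dense[OF b(1)] by blast
    with b(2) show "\<exists>q\<in>UNIV. c < (if real_of_rat q < x then \<Phi> t (ennreal (of_rat q)) else 0)"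
      by auto
  qed
qed (rule SUP_least, auto intro!: mono_arg ennreal_leI)

lemma measurable_comp [measurable]:
  assumes [measurable]: "u \<in> borel_measurable M"
  shows "(\<lambda>t. \<Phi> t (ennreal (u t))) \<in> borel_measurable M"
proof -
  note measurable_section [measurable]
  \<comment> \<open>Each term now involves a section at a fixed rational, and \<open>u\<close>
    enters only through the condition \<open>of_rat q < u t\<close>.\<close>
  have "\<Phi> t (ennreal (u t)) =
      (if 0 < u t then SUP q::rat. if of_rat q < u t then \<Phi> t (ennreal (of_rat q)) else 0 else 0)" for t
    using left_approx[of "u t" t] by (auto simp: ennreal_neg)
  then show ?thesis by simp
qed

section \<open>Young's inequality and the complementary function\<close>

lemma young:
  assumes "x < \<infinity>"
  shows "x * y \<le> \<Phi> t x + complementary \<Phi> t y"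
proof (cases "x = 0")
  case False
  then have "x * y - \<Phi> t x \<le> complementary \<Phi> t y"
    unfolding complementary_def using assms
    by (intro SUP_upper2[where i = x]) (auto simp: zero_less_iff_neq_zero)
  then show ?thesis
    by (meson diff_add_self_ennreal ennreal_minus_le_iff)
qed simp

lemma complementary_zero [simp]: "complementary \<Phi> t 0 = 0"
  unfolding complementary_def by (simp add: SUP_eq_const)

text \<open>Since \<open>c * \<Phi> t x \<le> \<Phi> t x\<close>, each term of the supremum at
  \<open>c * y\<close> is at most \<open>c\<close> times the same term at \<open>y\<close>.\<close>

lemma complementary_scale_le:
  assumes "c \<le> 1"
  shows "complementary \<Phi> t (c * y) \<le> c * complementary \<Phi> t y"
  unfolding complementary_def SUP_mult_left_ennreal
proof (rule SUP_mono)
  fix x :: ennreal assume x: "x \<in> {0<..<\<infinity>}"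
  have "c * (x * y) \<le> c * (\<Phi> t x + (x * y - \<Phi> t x))"
    by (intro mult_left_mono) (auto simp: add_diff_self_ennreal)
  also have "\<dots> \<le> 1 * \<Phi> t x + c * (x * y - \<Phi> t x)"
    unfolding distrib_left using assms by (intro add_right_mono mult_right_mono) auto
  finally have 1: "x * (c * y) \<le> \<Phi> t x + c * (x * y - \<Phi> t x)"
    by (simp add: mult.left_commute)
  have "c < top" using assms by (simp add: le_less_trans)
  \<comment> \<open>As \<open>top - top = top\<close>, turning the bound on the sum into one on the
    difference requires the infinite case separately.\<close>
  then have "x * (c * y) = top \<Longrightarrow> c * (x * y - \<Phi> t x) = top"
    using x by (auto simp: ennreal_mult_eq_top_iff)
  with 1 have "x * (c * y) - \<Phi> t x \<le> c * (x * y - \<Phi> t x)"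
    unfolding ennreal_minus_le_iff by blast
  then show "\<exists>z\<in>{0<..<\<infinity>}. x * (c * y) - \<Phi> t x \<le> c * (z * y - \<Phi> t z)" using x by blast
qed

text \<open>Moving \<open>u\<close> slightly down to a rational changes \<open>u * y\<close> little,
  by continuity, and does not increase \<open>\<Phi> t u\<close>. The countable supremum yields
  measurability of the complementary function along measurable functions.\<close>

lemma complementary_rat:
  "complementary \<Phi> t (ennreal y) = (SUP q\<in>{q::rat. 0 < q}. ennreal (of_rat q) * ennreal y - \<Phi> t (ennreal (of_rat q)))"
    (is "_ = ?R")
proof (rule antisym)
  show "complementary \<Phi> t (ennreal y) \<le> ?R"
    unfolding complementary_def
  proof (rule SUP_least)
    fix u :: ennreal assume u: "u \<in> {0<..<\<infinity>}"
    then obtain x where x: "u = ennreal x" "0 < x" by (cases u) auto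
    show "u * ennreal y - \<Phi> t u \<le> ?R"
    proof (rule dense_le)
      fix c assume c: "c < u * ennreal y - \<Phi> t u"
      then have cy: "c + \<Phi> t u < ennreal x * ennreal y"
        by (subst (asm) less_diff_eq_ennreal) (auto simp: x ennreal_mult_less_top)
      have "((\<lambda>w. ennreal w * ennreal y) \<longlongrightarrow> ennreal x * ennreal y) (at_left x)"
        unfolding mult.commute[of _ "ennreal y"]
        by (intro ennreal_tendsto_cmult tendsto_ennrealI tendsto_ident_at) auto
      then have "eventually (\<lambda>w. c + \<Phi> t u < ennreal w * ennreal y) (at_left x)"
        using cy order_tendstoD(1) by blast
      then obtain b where b: "b < x" "\<And>w. b < w \<Longrightarrow> w < x \<Longrightarrow> c + \<Phi> t u < ennreal w * ennreal y"
        unfolding eventually_at_left_field by blast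
      obtain q where q: "max b 0 < of_rat q" "of_rat q < x" using of_rat_dense[of "max b 0" x] b(1) x by auto
      have "\<Phi> t (ennreal (of_rat q)) \<le> \<Phi> t u"
        using q x by (intro mono_arg) (auto intro: ennreal_leI)
      moreover have "c + \<Phi> t u < ennreal (of_rat q) * ennreal y" using b(2) q by auto
      ultimately have "c + \<Phi> t (ennreal (of_rat q)) \<le> ennreal (of_rat q) * ennreal y"
        by (meson add_left_mono less_imp_le order_trans)
      then have "c \<le> ennreal (of_rat q) * ennreal y - \<Phi> t (ennreal (of_rat q))"
        by (simp add: ennreal_le_minus_iff)
      also have "\<dots> \<le> ?R" using q by (intro SUP_upper) auto
      finally show "c \<le> ?R" .
    qed
  qed
next
  show "?R \<le> complementary \<Phi> t (ennreal y)"
    unfolding complementary_def by (rule SUP_mono) auto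
qed

lemma measurable_comp_complementary [measurable]:
  assumes [measurable]: "v \<in> borel_measurable M"
  shows "(\<lambda>t. complementary \<Phi> t (ennreal (v t))) \<in> borel_measurable M"
proof -
  note measurable_section [measurable]
  show ?thesis unfolding complementary_rat by measurable
qed

section \<open>The modular and the linear structure of the Orlicz space\<close>

lemma modular_mono:
  assumes "AE t in M. \<bar>u t\<bar> \<le> \<bar>v t\<bar>"
  shows "modular M \<Phi> u \<le> modular M \<Phi> v"
  unfolding modular_def using assms
  by (intro nn_integral_mono_AE) (auto elim!: eventually_mono intro!: mono_arg ennreal_leI)

lemma modular_scale_le:
  assumes [measurable]: "u \<in> borel_measurable M" and "0 \<le> c" "c \<le> 1"
  shows "modular M \<Phi> (\<lambda>t. c * u t) \<le> ennreal c * modular M \<Phi> u"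
proof -
  have "modular M \<Phi> (\<lambda>t. c * u t) \<le> (\<integral>\<^sup>+ t. ennreal c * \<Phi> t (ennreal \<bar>u t\<bar>) \<partial>M)"
    unfolding modular_def
    using assms by (intro nn_integral_mono) (auto simp: abs_mult ennreal_mult intro!: scale_le)
  then show ?thesis by (simp add: nn_integral_cmult modular_def)
qed

text \<open>At each point one of the two terms on the right already dominates. The maximum in the
  hypothesis is the form in which a suitably scaled sum of two functions can be controlled.\<close>

lemma modular_le_add:
  assumes [measurable]: "u \<in> borel_measurable M" "v \<in> borel_measurable M"
    and "\<And>t. \<bar>w t\<bar> \<le> max \<bar>u t\<bar> \<bar>v t\<bar>"
  shows "modular M \<Phi> w \<le> modular M \<Phi> u + modular M \<Phi> v"
proof -
  have "\<Phi> t (ennreal \<bar>w t\<bar>) \<le> \<Phi> t (ennreal \<bar>u t\<bar>) + \<Phi> t (ennreal \<bar>v t\<bar>)" for t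
  proof (cases "\<bar>w t\<bar> \<le> \<bar>u t\<bar>")
    case True
    then show ?thesis by (intro add_increasing2 mono_arg ennreal_leI) auto
  next
    case False
    then show ?thesis using assms(3)[of t] by (intro add_increasing mono_arg ennreal_leI) auto
  qed
  then have "modular M \<Phi> w \<le> (\<integral>\<^sup>+ t. \<Phi> t (ennreal \<bar>u t\<bar>) + \<Phi> t (ennreal \<bar>v t\<bar>) \<partial>M)"
    unfolding modular_def by (intro nn_integral_mono)
  then show ?thesis by (simp add: nn_integral_add modular_def)
qed

lemma orlicz_space_dominated:
  assumes "u \<in> orlicz_space M \<Phi>" "w \<in> borel_measurable M" "AE t in M. \<bar>w t\<bar> \<le> \<bar>u t\<bar>"
  shows "w \<in> orlicz_space M \<Phi>"
proof -
  obtain l where l: "0 < l" "modular M \<Phi> (\<lambda>t. l * u t) < \<infinity>"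
    using assms(1) by (auto simp: orlicz_space_def)
  have "AE t in M. \<bar>l * w t\<bar> \<le> \<bar>l * u t\<bar>"
    using assms(3) by eventually_elim (use l(1) in \<open>auto simp: abs_mult\<close>)
  with l modular_mono[OF this] show ?thesis
    using assms(2) by (auto simp: orlicz_space_def intro: le_less_trans)
qed

lemma orlicz_space_add:
  assumes u: "u \<in> orlicz_space M \<Phi>" and v: "v \<in> orlicz_space M \<Phi>"
  shows "(\<lambda>t. u t + v t) \<in> orlicz_space M \<Phi>"
proof -
  have [measurable]: "u \<in> borel_measurable M" "v \<in> borel_measurable M"
    using u v by (auto simp: orlicz_space_def)
  obtain l where l: "0 < l" "modular M \<Phi> (\<lambda>t. l * u t) < \<infinity>"
    using u by (auto simp: orlicz_space_def)
  obtain k where k: "0 < k" "modular M \<Phi> (\<lambda>t. k * v t) < \<infinity>"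
    using v by (auto simp: orlicz_space_def)
  \<comment> \<open>The factor 1/2 makes \<open>m * \<bar>u t + v t\<bar>\<close> at most the
    average of \<open>l * \<bar>u t\<bar>\<close> and \<open>k * \<bar>v t\<bar>\<close>, hence at
    most their maximum.\<close>
  define m where "m = min l k / 2"
  have m: "0 < m" using l k by (simp add: m_def)
  have "\<bar>m * (u t + v t)\<bar> \<le> max \<bar>l * u t\<bar> \<bar>k * v t\<bar>" for t
  proof -
    have "\<bar>m * (u t + v t)\<bar> \<le> m * \<bar>u t\<bar> + m * \<bar>v t\<bar>"
      using m by (simp add: abs_mult flip: distrib_left)
    moreover have "m * \<bar>u t\<bar> \<le> (l / 2) * \<bar>u t\<bar>" "m * \<bar>v t\<bar> \<le> (k / 2) * \<bar>v t\<bar>"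
      by (intro mult_right_mono; simp add: m_def)+
    moreover have "\<bar>l * u t\<bar> = l * \<bar>u t\<bar>" "\<bar>k * v t\<bar> = k * \<bar>v t\<bar>"
      using l k by (simp_all add: abs_mult)
    ultimately show ?thesis by linarith
  qed
  then have "modular M \<Phi> (\<lambda>t. m * (u t + v t)) \<le> modular M \<Phi> (\<lambda>t. l * u t) + modular M \<Phi> (\<lambda>t. k * v t)"
    by (intro modular_le_add) auto
  also have "\<dots> < \<infinity>" using l k by simp
  finally show ?thesis using m by (auto simp: orlicz_space_def)
qed

lemma orlicz_space_scale:
  assumes "u \<in> orlicz_space M \<Phi>"
  shows "(\<lambda>t. c * u t) \<in> orlicz_space M \<Phi>"
proof (cases "c = 0")
  case True
  have "(\<lambda>t. 0) \<in> orlicz_space M \<Phi>"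
    by (auto simp: orlicz_space_def modular_def intro!: exI[of _ 1])
  then show ?thesis using True by simp
next
  case False
  obtain l where l: "0 < l" "modular M \<Phi> (\<lambda>t. l * u t) < \<infinity>"
    using assms by (auto simp: orlicz_space_def)
  have "modular M \<Phi> (\<lambda>t. (l / \<bar>c\<bar>) * (c * u t)) \<le> modular M \<Phi> (\<lambda>t. l * u t)"
    using False by (intro modular_mono) (auto simp: abs_mult)
  then show ?thesis using assms l False
    by (auto simp: orlicz_space_def intro!: exI[of _ "l / \<bar>c\<bar>"] intro: le_less_trans)
qed

lemma orlicz_space_diff:
  assumes "u \<in> orlicz_space M \<Phi>" "v \<in> orlicz_space M \<Phi>"
  shows "(\<lambda>t. u t - v t) \<in> orlicz_space M \<Phi>"
  using orlicz_space_add[OF assms(1) orlicz_space_scale[OF assms(2), of "-1"]] by simp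

lemma orlicz_space_divide_modular:
  assumes "u \<in> orlicz_space M \<Phi>"
  obtains l where "0 < l" "modular M \<Phi> (\<lambda>t. u t / l) < \<infinity>"
proof -
  obtain l where l: "0 < l" "modular M \<Phi> (\<lambda>t. l * u t) < \<infinity>"
    using assms by (auto simp: orlicz_space_def)
  then show thesis by (intro that[of "1 / l"]) (auto simp: mult.commute)
qed

section \<open>The Luxemburg and Orlicz norms\<close>

lemma luxemburg_norm_finite:
  assumes u: "u \<in> orlicz_space M \<Phi>"
  shows "luxemburg_norm M \<Phi> u < \<infinity>"
proof -
  have [measurable]: "u \<in> borel_measurable M" using u by (simp add: orlicz_space_def)
  obtain l where l: "0 < l" "modular M \<Phi> (\<lambda>t. u t / l) < \<infinity>"
    using orlicz_space_divide_modular[OF u] .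
  obtain K where K: "modular M \<Phi> (\<lambda>t. u t / l) = ennreal K" "0 \<le> K"
    using l(2) by (cases "modular M \<Phi> (\<lambda>t. u t / l)") auto
  \<comment> \<open>By convexity, shrinking the argument by the factor \<open>1 / m\<close> shrinks
    the finite modular \<open>K\<close> to at most \<open>K / m \<le> 1\<close>.\<close>
  define m where "m = max 1 K"
  have "modular M \<Phi> (\<lambda>t. (1 / m) * (u t / l)) \<le> ennreal (1 / m) * modular M \<Phi> (\<lambda>t. u t / l)"
    by (rule modular_scale_le) (auto simp: m_def)
  also have "\<dots> = ennreal (K / m)"
    unfolding K(1) by (subst ennreal_mult[symmetric]) (auto simp: m_def K)
  also have "\<dots> \<le> 1" by (simp add: m_def divide_le_eq K(2))
  finally have "modular M \<Phi> (\<lambda>t. u t / (l * m)) \<le> 1" by (simp add: mult.commute)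
  then have "luxemburg_norm M \<Phi> u \<le> ennreal (l * m)"
    unfolding luxemburg_norm_def using l by (intro INF_lower) (auto simp: m_def)
  then show ?thesis by (simp add: le_less_trans)
qed

lemma luxemburg_norm_mono:
  assumes "AE t in M. \<bar>u t\<bar> \<le> \<bar>v t\<bar>"
  shows "luxemburg_norm M \<Phi> u \<le> luxemburg_norm M \<Phi> v"
  unfolding luxemburg_norm_def
proof (rule INF_superset_mono)
  show "{l. 0 < l \<and> modular M \<Phi> (\<lambda>t. v t / l) \<le> 1} \<subseteq> {l. 0 < l \<and> modular M \<Phi> (\<lambda>t. u t / l) \<le> 1}"
  proof safe
    fix l :: real assume l: "0 < l" "modular M \<Phi> (\<lambda>t. v t / l) \<le> 1"
    have "modular M \<Phi> (\<lambda>t. u t / l) \<le> modular M \<Phi> (\<lambda>t. v t / l)"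
      using assms l(1) by (intro modular_mono) (auto simp: divide_right_mono)
    with l(2) show "modular M \<Phi> (\<lambda>t. u t / l) \<le> 1" by simp
  qed
qed simp

lemma luxemburg_norm_AE_zero:
  assumes "AE t in M. u t = 0"
  shows "luxemburg_norm M \<Phi> u = 0"
proof -
  have "luxemburg_norm M \<Phi> u \<le> ennreal e" if "0 < e" for e
  proof -
    have "modular M \<Phi> (\<lambda>t. u t / e) \<le> modular M \<Phi> (\<lambda>t. 0)"
      using assms by (intro modular_mono) auto
    then have "modular M \<Phi> (\<lambda>t. u t / e) \<le> 1" by (simp add: modular_def)
    with that have "e \<in> {l. 0 < l \<and> modular M \<Phi> (\<lambda>t. u t / l) \<le> 1}" by simp
    then show ?thesis unfolding luxemburg_norm_def by (rule INF_lower)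
  qed
  then have "luxemburg_norm M \<Phi> u \<le> 0 + ennreal e" if "0 < e" for e using that by simp
  then have "luxemburg_norm M \<Phi> u \<le> 0" by (rule ennreal_le_epsilon)
  then show ?thesis by simp
qed

lemma theta_le_luxemburg_norm: "theta M \<Phi> u \<le> luxemburg_norm M \<Phi> u"
  unfolding theta_def luxemburg_norm_def
  by (rule INF_superset_mono) (auto intro: le_less_trans)

text \<open>Young's inequality for \<open>w t / l\<close> and \<open>v t\<close>, integrated and
  multiplied by \<open>l\<close>; the test functions have complementary modular at most 1.\<close>

lemma orlicz_norm_le_modular:
  assumes [measurable]: "w \<in> borel_measurable M" and l: "0 < l"
  shows "orlicz_norm M \<Phi> w \<le> ennreal l * (modular M \<Phi> (\<lambda>t. w t / l) + 1)"
  unfolding orlicz_norm_def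
proof (rule SUP_least, safe)
  fix v assume v: "v \<in> orlicz_class M (complementary \<Phi>)" "modular M (complementary \<Phi>) v \<le> 1"
  then have [measurable]: "v \<in> borel_measurable M" by (simp add: orlicz_class_def)
  have "ennreal \<bar>LINT t|M. w t * v t\<bar> \<le> (\<integral>\<^sup>+ t. ennreal \<bar>w t * v t\<bar> \<partial>M)"
    \<comment> \<open>For a non-integrable product the Bochner integral is 0 by convention, so the
      bound holds there too.\<close>
    using integral_norm_bound_ennreal[of M "\<lambda>t. w t * v t"]
    by (cases "integrable M (\<lambda>t. w t * v t)") (auto simp: not_integrable_integral_eq)
  also have "\<dots> \<le> (\<integral>\<^sup>+ t. ennreal l * (\<Phi> t (ennreal \<bar>w t / l\<bar>) + complementary \<Phi> t (ennreal \<bar>v t\<bar>)) \<partial>M)"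
  proof (rule nn_integral_mono)
    fix t
    have "ennreal \<bar>w t * v t\<bar> = ennreal l * (ennreal \<bar>w t / l\<bar> * ennreal \<bar>v t\<bar>)"
      using l by (simp add: abs_mult flip: ennreal_mult)
    also have "\<dots> \<le> ennreal l * (\<Phi> t (ennreal \<bar>w t / l\<bar>) + complementary \<Phi> t (ennreal \<bar>v t\<bar>))"
      by (intro mult_left_mono young) auto
    finally show "ennreal \<bar>w t * v t\<bar> \<le> \<dots>" .
  qed
  also have "\<dots> = ennreal l * (modular M \<Phi> (\<lambda>t. w t / l) + modular M (complementary \<Phi>) v)"
    by (simp add: nn_integral_cmult nn_integral_add modular_def)
  also have "\<dots> \<le> ennreal l * (modular M \<Phi> (\<lambda>t. w t / l) + 1)"
    using v(2) by (intro mult_left_mono add_left_mono) auto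
  finally show "ennreal \<bar>LINT t|M. w t * v t\<bar> \<le> \<dots>" .
qed

lemma orlicz_norm_finite:
  assumes u: "u \<in> orlicz_space M \<Phi>"
  shows "orlicz_norm M \<Phi> u < \<infinity>"
proof -
  obtain l where l: "0 < l" "modular M \<Phi> (\<lambda>t. u t / l) < \<infinity>"
    using orlicz_space_divide_modular[OF u] .
  have "orlicz_norm M \<Phi> u \<le> ennreal l * (modular M \<Phi> (\<lambda>t. u t / l) + 1)"
    using u l by (intro orlicz_norm_le_modular) (auto simp: orlicz_space_def)
  also have "\<dots> < \<infinity>" using l by (auto simp: ennreal_mult_less_top)
  finally show ?thesis .
qed

section \<open>Null sequences and the upper bound \<open>theta\<close> for both quotient
  seminorms\<close>

lemma tendsto_comp_zero:
  assumes "x \<longlonglongrightarrow> 0"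
  shows "(\<lambda>n. \<Phi> t (ennreal (x n))) \<longlonglongrightarrow> 0"
proof (rule order_tendstoI)
  fix e :: ennreal assume "0 < e"
  with tendsto_zero[of t] have "eventually (\<lambda>w. \<Phi> t w < e) (at_right 0)"
    by (rule order_tendstoD)
  then obtain b where b: "0 < b" "\<And>w. 0 < w \<Longrightarrow> w < b \<Longrightarrow> \<Phi> t w < e"
    unfolding eventually_at_right[OF zero_less_one] by blast
  have "(\<lambda>n. ennreal (x n)) \<longlonglongrightarrow> ennreal 0" by (intro tendsto_ennrealI assms)
  then have "eventually (\<lambda>n. ennreal (x n) < b) sequentially"
    using b(1) by (intro order_tendstoD) auto
  then show "eventually (\<lambda>n. \<Phi> t (ennreal (x n)) < e) sequentially"
  proof eventually_elim
    case (elim n)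
    \<comment> \<open>The assumed limit at 0 is one-sided and excludes 0 itself, where
      \<open>\<Phi> t\<close> vanishes by assumption.\<close>
    then show ?case using b(2) \<open>0 < e\<close> by (cases "ennreal (x n) = 0") (auto simp: zero_less_iff_neq_zero)
  qed
qed simp

lemma modular_null_seq:
  assumes "u \<in> borel_measurable M" "us \<in> null_seqs M u" "0 < l" "modular M \<Phi> (\<lambda>t. u t / l) < \<infinity>"
  shows "(\<lambda>n. modular M \<Phi> (\<lambda>t. us n t / l)) \<longlonglongrightarrow> 0"
proof -
  have [measurable]: "u \<in> borel_measurable M" "\<And>n. us n \<in> borel_measurable M"
    using assms by (auto simp: null_seqs_def)
  have ae: "AE t in M. (\<forall>n. 0 \<le> us n t \<and> us n t \<le> \<bar>u t\<bar>) \<and> (\<lambda>n. us n t) \<longlonglongrightarrow> 0"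
    using assms(2) by (auto simp: null_seqs_def)
  have "(\<lambda>n. \<integral>\<^sup>+ t. \<Phi> t (ennreal \<bar>us n t / l\<bar>) \<partial>M) \<longlonglongrightarrow> (\<integral>\<^sup>+ t. 0 \<partial>M)"
  proof (rule nn_integral_dominated_convergence[where w = "\<lambda>t. \<Phi> t (ennreal \<bar>u t / l\<bar>)"])
    show "AE t in M. \<Phi> t (ennreal \<bar>us j t / l\<bar>) \<le> \<Phi> t (ennreal \<bar>u t / l\<bar>)" for j
      using ae by eventually_elim (use assms(3) in \<open>auto intro!: mono_arg ennreal_leI divide_right_mono\<close>)
    show "(\<integral>\<^sup>+ t. \<Phi> t (ennreal \<bar>u t / l\<bar>) \<partial>M) < \<infinity>"
      using assms(4) by (simp add: modular_def)
    show "AE t in M. (\<lambda>i. \<Phi> t (ennreal \<bar>us i t / l\<bar>)) \<longlonglongrightarrow> 0"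
      using ae by eventually_elim (use assms(3) in \<open>auto intro!: tendsto_comp_zero tendsto_eq_intros\<close>)
  qed auto
  then show ?thesis by (simp add: modular_def)
qed

lemma Q_lux_le_theta:
  assumes "u \<in> borel_measurable M"
  shows "Q_lux M \<Phi> u \<le> theta M \<Phi> u"
  unfolding Q_lux_def theta_def
proof (intro SUP_least INF_greatest, safe)
  fix us and l :: real assume us: "us \<in> null_seqs M u" and l: "0 < l" "modular M \<Phi> (\<lambda>t. u t / l) < \<infinity>"
  have "eventually (\<lambda>n. modular M \<Phi> (\<lambda>t. us n t / l) < 1) sequentially"
    using modular_null_seq[OF assms us l] by (rule order_tendstoD) simp
  then obtain n where "modular M \<Phi> (\<lambda>t. us n t / l) < 1"
    by (auto simp: eventually_sequentially)
  then have "luxemburg_norm M \<Phi> (us n) \<le> ennreal l"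
    unfolding luxemburg_norm_def using l by (intro INF_lower) auto
  then show "(INF n. luxemburg_norm M \<Phi> (us n)) \<le> ennreal l" by (rule INF_lower2[rotated]) simp
qed

text \<open>The bound \<open>l * (I + 1)\<close> on the Orlicz norm, \<open>I\<close> being the
  modular of \<open>us n\<close> divided by \<open>l\<close>, only tends to \<open>l\<close>. The
  infimum is therefore compared with a limit, whereas for the Luxemburg norm a single index
  suffices.\<close>

lemma Q_orl_le_theta:
  assumes "u \<in> borel_measurable M"
  shows "Q_orl M \<Phi> u \<le> theta M \<Phi> u"
  unfolding Q_orl_def theta_def
proof (intro SUP_least INF_greatest, safe)
  fix us and l :: real assume us: "us \<in> null_seqs M u" and l: "0 < l" "modular M \<Phi> (\<lambda>t. u t / l) < \<infinity>"
  have "(\<lambda>n. ennreal l * (modular M \<Phi> (\<lambda>t. us n t / l) + 1)) \<longlonglongrightarrow> ennreal l * (0 + 1)"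
    by (intro ennreal_tendsto_cmult tendsto_add modular_null_seq[OF assms us l] tendsto_const) simp
  then have "(INF n. orlicz_norm M \<Phi> (us n)) \<le> ennreal l * (0 + 1)"
  proof (rule LIMSEQ_le_const, intro exI[of _ 0] allI impI)
    fix n
    have "(INF n. orlicz_norm M \<Phi> (us n)) \<le> orlicz_norm M \<Phi> (us n)" by (rule INF_lower) simp
    also have "\<dots> \<le> ennreal l * (modular M \<Phi> (\<lambda>t. us n t / l) + 1)"
      using us l by (intro orlicz_norm_le_modular) (auto simp: null_seqs_def)
    finally show "(INF n. orlicz_norm M \<Phi> (us n)) \<le> \<dots>" .
  qed
  then show "(INF n. orlicz_norm M \<Phi> (us n)) \<le> ennreal l" by simp
qed

text \<open>The sign can be moved onto the test function, whose modular sees only absolute values.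
  Applying the inequality twice and using \<open>s t * s t = 1\<close> gives equality.\<close>

lemma orlicz_norm_sign:
  assumes s: "s \<in> borel_measurable M" "\<And>t. \<bar>s t\<bar> = 1"
  shows "orlicz_norm M \<Phi> (\<lambda>t. s t * w t) = orlicz_norm M \<Phi> w"
proof -
  have *: "orlicz_norm M \<Phi> (\<lambda>t. s t * w t) \<le> orlicz_norm M \<Phi> w" for w
    unfolding orlicz_norm_def
  proof (rule SUP_least, safe)
    fix v assume v: "v \<in> orlicz_class M (complementary \<Phi>)" "modular M (complementary \<Phi>) v \<le> 1"
    have "modular M (complementary \<Phi>) (\<lambda>t. s t * v t) = modular M (complementary \<Phi>) v"
      unfolding modular_def by (simp add: abs_mult s)
    with v s have "(\<lambda>t. s t * v t) \<in> {v \<in> orlicz_class M (complementary \<Phi>). modular M (complementary \<Phi>) v \<le> 1}"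
      by (auto simp: orlicz_class_def)
    then show "ennreal \<bar>LINT t|M. s t * w t * v t\<bar> \<le> (SUP v\<in>{v \<in> orlicz_class M (complementary \<Phi>).
        modular M (complementary \<Phi>) v \<le> 1}. ennreal \<bar>LINT t|M. w t * v t\<bar>)"
      by (rule SUP_upper2) (simp add: ac_simps)
  qed
  have "s t * s t = 1" for t
    using s(2)[of t] by (metis abs_mult_self_eq mult_1)
  then have "(\<lambda>t. s t * (s t * w t)) = w" by (simp flip: mult.assoc)
  with *[of w] *[of "\<lambda>t. s t * w t"] show ?thesis by simp
qed

subsection \<open>Comparison of \<open>\<theta>\<close> with the Orlicz norm\<close>

text \<open>The three-point form of convexity, with denominators cleared and values taken in the
  reals so that slopes can be handled by linear arithmetic. Finiteness at the right endpoint
  \<open>z\<close> makes all the values involved finite.\<close>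

lemma chord:
  assumes "0 \<le> r" "r \<le> s" "s \<le> z" "r < z" "\<Phi> t (ennreal z) < top"
  shows "(z - r) * enn2real (\<Phi> t (ennreal s)) \<le>
    (z - s) * enn2real (\<Phi> t (ennreal r)) + (s - r) * enn2real (\<Phi> t (ennreal z))"
proof -
  \<comment> \<open>These are the weights that express \<open>s\<close> as a convex combination of
    \<open>r\<close> and \<open>z\<close>.\<close>
  define a b where "a = (z - s) / (z - r)" and "b = (s - r) / (z - r)"
  have ab: "0 \<le> a" "0 \<le> b" "a + b = 1"
    using assms by (auto simp: a_def b_def add_divide_distrib[symmetric])
  have zr: "(z - r) * a = z - s" "(z - r) * b = s - r"
    using assms(4) by (auto simp: a_def b_def)
  have "(z - r) * (a * r + b * z) = ((z - r) * a) * r + ((z - r) * b) * z"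
    by (simp add: algebra_simps)
  also have "\<dots> = (z - r) * s" unfolding zr by (simp add: algebra_simps)
  finally have s: "a * r + b * z = s" using assms(4) by simp
  have fin: "\<Phi> t (ennreal w) = ennreal (enn2real (\<Phi> t (ennreal w)))" if "w \<le> z" for w
  proof -
    have "\<Phi> t (ennreal w) \<le> \<Phi> t (ennreal z)" using that by (intro mono_arg ennreal_leI)
    with assms(5) show ?thesis by (simp add: le_less_trans)
  qed
  have "\<Phi> t (ennreal s) = \<Phi> t (ennreal a * ennreal r + ennreal b * ennreal z)"
    using ab assms by (simp flip: ennreal_mult ennreal_plus s)
  also have "\<dots> \<le> ennreal a * \<Phi> t (ennreal r) + ennreal b * \<Phi> t (ennreal z)"
    using ab by (intro convexD) (simp flip: ennreal_plus)
  finally have "ennreal (enn2real (\<Phi> t (ennreal s))) \<le>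
      ennreal (a * enn2real (\<Phi> t (ennreal r)) + b * enn2real (\<Phi> t (ennreal z)))"
    using ab assms fin[of s] fin[of r] fin[of z] by (simp add: ennreal_plus ennreal_mult)
  then have "enn2real (\<Phi> t (ennreal s)) \<le> a * enn2real (\<Phi> t (ennreal r)) + b * enn2real (\<Phi> t (ennreal z))"
    using ab by (subst (asm) ennreal_le_iff) auto
  then have "(z - r) * enn2real (\<Phi> t (ennreal s)) \<le>
      (z - r) * (a * enn2real (\<Phi> t (ennreal r)) + b * enn2real (\<Phi> t (ennreal z)))"
    using assms(4) by (intro mult_left_mono) auto
  also have "\<dots> = (z - r) * a * enn2real (\<Phi> t (ennreal r)) + (z - r) * b * enn2real (\<Phi> t (ennreal z))"
    by (simp add: algebra_simps)
  finally show ?thesis unfolding zr .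
qed

text \<open>The slope of a chord of \<open>\<Phi> t\<close> replaces a subgradient, which makes a measurable selection
  unnecessary at the price of two different arguments \<open>p < q\<close> in Young's equality.\<close>

lemma chord_slope_young:
  assumes "0 \<le> p" "p < q" "\<Phi> t (ennreal q) < top"
  defines "v \<equiv> (enn2real (\<Phi> t (ennreal q)) - enn2real (\<Phi> t (ennreal p))) / (q - p)"
  shows "0 \<le> v" "complementary \<Phi> t (ennreal v) + \<Phi> t (ennreal p) \<le> ennreal (q * v)"
proof -
  define F where "F w = enn2real (\<Phi> t (ennreal w))" for w
  have F_mono: "F x \<le> F y" if "x \<le> y" "\<Phi> t (ennreal y) < top" for x y
    unfolding F_def using that by (intro enn2real_mono mono_arg ennreal_leI)
  have ch: "(z - r) * F s \<le> (z - s) * F r + (s - r) * F z"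
    if "0 \<le> r" "r \<le> s" "s \<le> z" "r < z" "\<Phi> t (ennreal z) < top" for r s z
    using chord[OF that] by (simp add: F_def)
  have Fq: "F q = F p + v * (q - p)" using assms(2) by (simp add: v_def F_def)
  have pq: "F p \<le> F q" using assms by (intro F_mono) auto
  show v0: "0 \<le> v" using pq assms(2) by (simp add: v_def F_def)
  have F0: "F 0 = 0" by (simp add: F_def)
  have p_top: "\<Phi> t (ennreal p) < top"
    using mono_arg[OF ennreal_leI[of p q], of t] assms by (simp add: le_less_trans)
  \<comment> \<open>The chord from 0 to \<open>q\<close> leads to \<open>F p \<le> q * v\<close>.
    This nonnegativity of \<open>q * v - F p\<close> lets the extended sum be recombined at the
    end.\<close>
  have "q * F p \<le> p * F q"
    using ch[of 0 p q] assms F0 by simp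
  then have "(q - p) * F p \<le> (q - p) * (p * v)" by (simp add: Fq algebra_simps)
  then have "F p \<le> p * v" using assms(2) by simp
  also have "\<dots> \<le> q * v" using assms v0 by (intro mult_right_mono) auto
  finally have Fpqv: "F p \<le> q * v" .
  \<comment> \<open>Outside the interval from \<open>p\<close> to \<open>q\<close> the graph of
    \<open>F\<close> lies above the line through its points at \<open>p\<close> and
    \<open>q\<close>. Inside, \<open>F p \<le> F w\<close> and \<open>w \<le> q\<close> already
    suffice.\<close>
  have key: "w * v - F w \<le> q * v - F p" if w: "0 < w" "\<Phi> t (ennreal w) < top" for w
  proof -
    consider "w < p" | "p \<le> w" "w \<le> q" | "q < w" by linarith
    then show ?thesis
    proof cases
      case 1
      have "(q - w) * F p \<le> (q - p) * F w + (p - w) * F q"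
        using ch[of w p q] 1 w assms by simp
      then have "(q - p) * F p \<le> (q - p) * (F w + (p - w) * v)"
        by (simp add: Fq algebra_simps)
      then have "F p \<le> F w + (p - w) * v" using assms(2) by simp
      moreover have "p * v \<le> q * v" using assms v0 by (intro mult_right_mono) auto
      ultimately show ?thesis by (simp add: algebra_simps)
    next
      case 2
      have "F p \<le> F w" using 2 w by (intro F_mono) auto
      moreover have "w * v \<le> q * v" using 2 v0 by (intro mult_right_mono) auto
      ultimately show ?thesis by linarith
    next
      case 3
      have "(w - p) * F q \<le> (w - q) * F p + (q - p) * F w"
        using ch[of p q w] 3 w assms by simp
      then have "(q - p) * (F q + v * (w - q)) \<le> (q - p) * F w"
        by (simp add: Fq algebra_simps)
      then have "F q + v * (w - q) \<le> F w" using assms(2) by simp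
      with pq show ?thesis by (simp add: algebra_simps)
    qed
  qed
  have "complementary \<Phi> t (ennreal v) \<le> ennreal (q * v - F p)"
    unfolding complementary_def
  proof (rule SUP_least)
    fix u :: ennreal assume u: "u \<in> {0<..<\<infinity>}"
    then obtain w where w: "u = ennreal w" "0 < w" by (cases u) auto
    show "u * ennreal v - \<Phi> t u \<le> ennreal (q * v - F p)"
    proof (cases "\<Phi> t (ennreal w) < top")
      case True
      then have "\<Phi> t u = ennreal (F w)" by (simp add: w F_def)
      then have "u * ennreal v - \<Phi> t u = ennreal (w * v) - ennreal (F w)"
        using w v0 by (simp add: ennreal_mult)
      also have "\<dots> = ennreal (w * v - F w)"
        by (rule ennreal_minus) (simp add: F_def)
      finally have "u * ennreal v - \<Phi> t u = ennreal (w * v - F w)" .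
      with key[OF w(2) True] show ?thesis by (simp add: ennreal_leI)
    next
      case False
      then have "\<Phi> t u = top" by (simp add: w flip: less_top)
      then show ?thesis using w v0 by (simp flip: ennreal_mult)
    qed
  qed
  then have "complementary \<Phi> t (ennreal v) + \<Phi> t (ennreal p) \<le> ennreal (q * v - F p) + ennreal (F p)"
    using p_top by (intro add_mono) (auto simp: F_def)
  also have "\<dots> = ennreal (q * v)"
    using Fpqv by (subst ennreal_plus[symmetric]) (auto simp: F_def)
  finally show "complementary \<Phi> t (ennreal v) + \<Phi> t (ennreal p) \<le> ennreal (q * v)" .
qed

text \<open>By monotonicity \<open>\<Phi> t\<close> is infinite from \<open>q\<close> on, so for
  finite \<open>y\<close> only arguments up to \<open>q\<close> contribute to the supremum.\<close>

lemma complementary_le_of_infinite: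
  assumes "\<Phi> t q = top"
  shows "complementary \<Phi> t y \<le> q * y"
  unfolding complementary_def
proof (rule SUP_least)
  fix u :: ennreal assume u: "u \<in> {0<..<\<infinity>}"
  show "u * y - \<Phi> t u \<le> q * y"
  proof (cases "u \<le> q")
    case True
    then show ?thesis by (intro ennreal_diff_le_mono_left mult_right_mono) auto
  next
    case False
    then have "q \<le> u" by simp
    then have top: "\<Phi> t u = top" using mono_arg[of q u t] assms by (simp add: top_unique)
    show ?thesis
    \<comment> \<open>An infinite \<open>y\<close> makes the truncated difference
      \<open>top - top = top\<close>, so it is bounded directly.\<close>
    proof (cases "y = top")
      case True
      have "q \<noteq> 0" using assms by auto
      then show ?thesis using True by simp
    next
      case False
      then have "u * y < top" using u by (auto simp: ennreal_mult_less_top less_top)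
      then show ?thesis using top by (auto simp: minus_top_ennreal)
    qed
  qed
qed

text \<open>The function \<open>v\<close> need not be an admissible test function. With
  \<open>I\<close> its complementary modular and \<open>c = 1 / max 1 I\<close>, the multiple
  \<open>c * v\<close> has modular at most \<open>c * I \<le> 1\<close> and still pairs with
  \<open>\<bar>u\<bar>\<close> to at least \<open>c * (I + 1) \<ge> 1\<close>.\<close>

lemma one_le_orlicz_norm:
  assumes [measurable]: "u \<in> borel_measurable M" "v \<in> borel_measurable M"
    and v: "\<And>t. 0 \<le> v t"
    and fin: "(\<integral>\<^sup>+ t. ennreal (\<bar>u t\<bar> * v t) \<partial>M) < top"
    and le: "(\<integral>\<^sup>+ t. complementary \<Phi> t (ennreal (v t)) \<partial>M) + 1 \<le> (\<integral>\<^sup>+ t. ennreal (\<bar>u t\<bar> * v t) \<partial>M)"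
  shows "1 \<le> orlicz_norm M \<Phi> u"
proof -
  define I where "I = enn2real (\<integral>\<^sup>+ t. complementary \<Phi> t (ennreal (v t)) \<partial>M)"
  have "(\<integral>\<^sup>+ t. complementary \<Phi> t (ennreal (v t)) \<partial>M) < top"
    using le fin by (metis add_top ennreal_add_less_top le_less_trans)
  then have I: "(\<integral>\<^sup>+ t. complementary \<Phi> t (ennreal (v t)) \<partial>M) = ennreal I" "0 \<le> I"
    by (auto simp: I_def)
  define c where "c = 1 / max 1 I"
  have c: "0 < c" "c \<le> 1" by (auto simp: c_def divide_le_eq)
  \<comment> \<open>The sign of \<open>u\<close> makes the product \<open>u t * w t\<close>
    nonnegative.\<close>
  define w where "w t = (if u t < 0 then -1 else 1) * (c * v t)" for t
  have [measurable]: "w \<in> borel_measurable M" unfolding w_def by measurable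
  have w_abs: "\<bar>w t\<bar> = c * v t" for t using v[of t] c by (simp add: w_def)
  have uw: "u t * w t = c * (\<bar>u t\<bar> * v t)" for t by (simp add: w_def)
  have "modular M (complementary \<Phi>) w \<le> (\<integral>\<^sup>+ t. ennreal c * complementary \<Phi> t (ennreal (v t)) \<partial>M)"
    unfolding modular_def w_abs using c v
    by (intro nn_integral_mono) (auto simp: ennreal_mult intro!: complementary_scale_le)
  also have "\<dots> = ennreal (c * I)"
    using c I by (simp add: nn_integral_cmult ennreal_mult)
  also have "\<dots> \<le> 1" using I(2) by (simp add: c_def divide_le_eq)
  finally have w1: "modular M (complementary \<Phi>) w \<le> 1" .
  then have "w \<in> {v \<in> orlicz_class M (complementary \<Phi>). modular M (complementary \<Phi>) v \<le> 1}"
    by (auto simp: orlicz_class_def le_less_trans)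
  then have "ennreal \<bar>LINT t|M. u t * w t\<bar> \<le> orlicz_norm M \<Phi> u"
    unfolding orlicz_norm_def by (rule SUP_upper)
  moreover have "1 \<le> ennreal \<bar>LINT t|M. u t * w t\<bar>"
  proof -
    have "ennreal (I + 1) = (\<integral>\<^sup>+ t. complementary \<Phi> t (ennreal (v t)) \<partial>M) + 1"
      using I by simp
    then have "ennreal (I + 1) \<le> (\<integral>\<^sup>+ t. ennreal (\<bar>u t\<bar> * v t) \<partial>M)" using le by simp
    then have "ennreal c * ennreal (I + 1) \<le> ennreal c * (\<integral>\<^sup>+ t. ennreal (\<bar>u t\<bar> * v t) \<partial>M)"
      by (rule mult_left_mono) simp
    also have "\<dots> = (\<integral>\<^sup>+ t. ennreal (u t * w t) \<partial>M)"
      unfolding uw using c v by (simp add: ennreal_mult flip: nn_integral_cmult)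
    finally have *: "ennreal (c * (I + 1)) \<le> (\<integral>\<^sup>+ t. ennreal (u t * w t) \<partial>M)"
      using c I by (simp add: ennreal_mult)
    have "(\<integral>\<^sup>+ t. ennreal (u t * w t) \<partial>M) = ennreal c * (\<integral>\<^sup>+ t. ennreal (\<bar>u t\<bar> * v t) \<partial>M)"
      unfolding uw using c v by (simp add: ennreal_mult flip: nn_integral_cmult)
    also have "\<dots> < top" using fin by (simp add: ennreal_mult_less_top)
    finally have "integrable M (\<lambda>t. u t * w t)"
      using c v by (intro integrableI_nonneg) (auto simp: uw)
    then have "(\<integral>\<^sup>+ t. ennreal (u t * w t) \<partial>M) = ennreal (LINT t|M. u t * w t)"
      using c v by (intro nn_integral_eq_integral) (auto simp: uw)
    moreover have "1 \<le> c * (I + 1)" using I(2) by (simp add: c_def le_divide_eq)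
    ultimately show ?thesis using * by (metis abs_ge_self dual_order.trans ennreal_1 ennreal_leI)
  qed
  ultimately show ?thesis by (rule order_trans[rotated])
qed

lemma exists_multiple_ge_one:
  fixes d :: ennreal
  assumes "0 < d"
  shows "\<exists>n::nat. 1 \<le> ennreal (real n) * d"
proof (cases d)
  case (real r)
  with assms have "0 < r" by simp
  then obtain n where "1 < real n * r" using reals_Archimedean3[of r] by blast
  then show ?thesis using real by (intro exI[of _ n]) (simp flip: ennreal_mult)
next
  case top
  then show ?thesis by (intro exI[of _ 1]) simp
qed

text \<open>A function \<open>v\<close> suited to \<open>one_le_orlicz_norm\<close> is built in two
  cases. If \<open>\<Phi> t (b * \<bar>u t\<bar>)\<close> is infinite on a set of positive measure,
  \<open>v\<close> is a large function on that set. Otherwise \<open>v\<close> is the slope of the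
  chord from \<open>a * \<bar>u t\<bar>\<close> to \<open>b * \<bar>u t\<bar>\<close>, truncated so
  that its pairing with \<open>\<bar>u\<bar>\<close> is finite but the modular of
  \<open>a * u\<close> on the truncation set exceeds 1.\<close>

lemma one_le_orlicz_norm_of_modular_infinite:
  assumes u [measurable]: "u \<in> borel_measurable M"
    and a: "0 < a" "a < 1"
    and inf: "modular M \<Phi> (\<lambda>t. a * u t) = top"
  shows "1 \<le> orlicz_norm M \<Phi> u"
proof -
  \<comment> \<open>A strictly positive integrable function, which exists by sigma-finiteness,
    serves as the scale that keeps \<open>\<bar>u\<bar> * v\<close> integrable.\<close>
  obtain h0 where h0 [measurable]: "h0 \<in> borel_measurable M" and h0_fin: "(\<integral>\<^sup>+ t. h0 t \<partial>M) \<noteq> \<infinity>"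
    and h0_pos: "\<And>t. t \<in> space M \<Longrightarrow> 0 < h0 t \<and> h0 t < \<infinity>"
    using Ex_finite_integrable_function by blast
  define h where "h t = enn2real (h0 t)" for t
  have [measurable]: "h \<in> borel_measurable M" unfolding h_def by measurable
  have h_pos: "0 < h t" if "t \<in> space M" for t
    using h0_pos[OF that] by (auto simp: h_def enn2real_positive_iff)
  have h_nonneg: "0 \<le> h t" for t by (simp add: h_def)
  have "(\<integral>\<^sup>+ t. ennreal (h t) \<partial>M) = (\<integral>\<^sup>+ t. h0 t \<partial>M)"
    using h0_pos by (intro nn_integral_cong) (auto simp: h_def)
  then have h_fin: "(\<integral>\<^sup>+ t. ennreal (h t) \<partial>M) < top" using h0_fin by (simp add: less_top)
  \<comment> \<open>A number strictly between \<open>a\<close> and 1: \<open>a < b\<close> separates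
    the endpoints of the chord, and \<open>b < 1\<close> leaves the slack
    \<open>(1 - b) * \<bar>u t\<bar> * v t\<close> when \<open>\<Phi>\<close> is infinite.\<close>
  define b where "b = (1 + a) / 2"
  have b: "a < b" "b < 1" "0 < b" using a by (auto simp: b_def)
  define B where "B = {t \<in> space M. \<Phi> t (ennreal (b * \<bar>u t\<bar>)) = top}"
  have [measurable]: "B \<in> sets M" unfolding B_def by measurable
  show ?thesis
  proof (cases "emeasure M B = 0")
    case False
    have "0 < (\<integral>\<^sup>+ t. ennreal (h t) * indicator B t \<partial>M)"
    proof (rule ccontr)
      assume "\<not> ?thesis"
      then have "(\<integral>\<^sup>+ t. ennreal (h t) * indicator B t \<partial>M) = 0" by simp
      then have "AE t in M. ennreal (h t) * indicator B t = 0"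
        by (subst (asm) nn_integral_0_iff_AE) auto
      then have "AE t in M. t \<notin> B"
        using AE_space by eventually_elim (use h_pos in \<open>force split: split_indicator_asm\<close>)
      then show False using False by (simp add: AE_iff_null_sets[symmetric] null_sets_def)
    qed
    then obtain n where n: "1 \<le> ennreal (real n) * (\<integral>\<^sup>+ t. ennreal (h t) * indicator B t \<partial>M)"
      using exists_multiple_ge_one by blast
    \<comment> \<open>Chosen so that the slack \<open>(1 - b) * \<bar>u t\<bar> * v t\<close> equals
      \<open>n * h t\<close> on \<open>B\<close>. There \<open>u t\<close> is nonzero because
      \<open>\<Phi> t 0 = 0\<close>.\<close>
    define v where "v t = (if t \<in> B then real n * h t / ((1 - b) * \<bar>u t\<bar>) else 0)" for t
    have [measurable]: "v \<in> borel_measurable M" unfolding v_def by measurable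
    have u_pos: "0 < \<bar>u t\<bar>" if "t \<in> B" for t
      using that by (cases "u t = 0") (auto simp: B_def)
    have uv: "\<bar>u t\<bar> * v t = indicator B t * (real n * h t / (1 - b))" for t
      using u_pos[of t] by (auto simp: v_def split: split_indicator)
    have v_nonneg: "0 \<le> v t" for t using b h_nonneg[of t] by (simp add: v_def)
    have pointwise: "complementary \<Phi> t (ennreal (v t)) + ennreal (real n) * (ennreal (h t) * indicator B t)
        \<le> ennreal (\<bar>u t\<bar> * v t)" for t
    proof (cases "t \<in> B")
      case True
      have "complementary \<Phi> t (ennreal (v t)) \<le> ennreal (b * \<bar>u t\<bar>) * ennreal (v t)"
        using True by (intro complementary_le_of_infinite) (simp add: B_def)
      also have "\<dots> = ennreal (b * (real n * h t / (1 - b)))"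
        using b v_nonneg True uv[of t] by (simp add: mult.assoc flip: ennreal_mult)
      finally have "complementary \<Phi> t (ennreal (v t)) + ennreal (real n) * (ennreal (h t) * indicator B t)
          \<le> ennreal (b * (real n * h t / (1 - b))) + ennreal (real n * h t)"
        using True h_nonneg[of t] by (intro add_mono) (auto simp: ennreal_mult)
      also have "\<dots> = ennreal (b * (real n * h t / (1 - b)) + real n * h t)"
        using b h_nonneg[of t] by (intro ennreal_plus[symmetric]) auto
      also have "b * (real n * h t / (1 - b)) + real n * h t = real n * h t / (1 - b)"
        using b by (simp add: field_simps)
      finally show ?thesis using True by (simp add: uv)
    qed (simp add: v_def)
    show ?thesis
    proof (rule one_le_orlicz_norm)
      show "(\<integral>\<^sup>+ t. ennreal (\<bar>u t\<bar> * v t) \<partial>M) < top"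
      proof -
        have "(\<integral>\<^sup>+ t. ennreal (\<bar>u t\<bar> * v t) \<partial>M) \<le> (\<integral>\<^sup>+ t. ennreal (real n / (1 - b)) * ennreal (h t) \<partial>M)"
          using b h_nonneg by (intro nn_integral_mono)
            (auto simp: uv simp flip: ennreal_mult split: split_indicator)
        also have "\<dots> < top" using h_fin by (simp add: nn_integral_cmult ennreal_mult_less_top)
        finally show ?thesis .
      qed
      have "(\<integral>\<^sup>+ t. complementary \<Phi> t (ennreal (v t)) \<partial>M) + 1
          \<le> (\<integral>\<^sup>+ t. complementary \<Phi> t (ennreal (v t)) \<partial>M)
            + (\<integral>\<^sup>+ t. ennreal (real n) * (ennreal (h t) * indicator B t) \<partial>M)"
        using n by (intro add_left_mono) (simp add: nn_integral_cmult)
      also have "\<dots> = (\<integral>\<^sup>+ t. complementary \<Phi> t (ennreal (v t))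
            + ennreal (real n) * (ennreal (h t) * indicator B t) \<partial>M)"
        by (simp add: nn_integral_add)
      also have "\<dots> \<le> (\<integral>\<^sup>+ t. ennreal (\<bar>u t\<bar> * v t) \<partial>M)"
        using pointwise by (intro nn_integral_mono)
      finally show "(\<integral>\<^sup>+ t. complementary \<Phi> t (ennreal (v t)) \<partial>M) + 1
          \<le> (\<integral>\<^sup>+ t. ennreal (\<bar>u t\<bar> * v t) \<partial>M)" .
    qed (use v_nonneg in auto)
  next
    case True
    have fin_AE: "AE t in M. \<Phi> t (ennreal (b * \<bar>u t\<bar>)) < top"
      by (rule AE_I'[of B]) (use True in \<open>auto simp: null_sets_def B_def simp flip: less_top\<close>)
    \<comment> \<open>The default 0 is used only on a null set in this case. Where
      \<open>u t = 0\<close> the quotient is \<open>0 / 0 = 0\<close>.\<close>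
    define v0 where "v0 t = (if \<Phi> t (ennreal (b * \<bar>u t\<bar>)) = top then 0 else
      (enn2real (\<Phi> t (ennreal (b * \<bar>u t\<bar>))) - enn2real (\<Phi> t (ennreal (a * \<bar>u t\<bar>))))
        / (b * \<bar>u t\<bar> - a * \<bar>u t\<bar>))" for t
    have [measurable]: "v0 \<in> borel_measurable M" unfolding v0_def by measurable
    have v0: "0 \<le> v0 t \<and> (\<Phi> t (ennreal (b * \<bar>u t\<bar>)) < top \<longrightarrow>
        complementary \<Phi> t (ennreal (v0 t)) + \<Phi> t (ennreal (a * \<bar>u t\<bar>)) \<le> ennreal (\<bar>u t\<bar> * v0 t))" for t
    proof (cases "u t = 0 \<or> \<Phi> t (ennreal (b * \<bar>u t\<bar>)) = top")
      case True
      then show ?thesis by (auto simp: v0_def)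
    next
      case False
      have 1: "0 \<le> a * \<bar>u t\<bar>" "a * \<bar>u t\<bar> < b * \<bar>u t\<bar>" "\<Phi> t (ennreal (b * \<bar>u t\<bar>)) < top"
        using False a b by (auto simp: less_top)
      have v0_eq: "v0 t = (enn2real (\<Phi> t (ennreal (b * \<bar>u t\<bar>))) - enn2real (\<Phi> t (ennreal (a * \<bar>u t\<bar>))))
        / (b * \<bar>u t\<bar> - a * \<bar>u t\<bar>)" using False by (simp add: v0_def)
      have pos: "0 \<le> v0 t" unfolding v0_eq using 1 by (rule chord_slope_young)
      have "complementary \<Phi> t (ennreal (v0 t)) + \<Phi> t (ennreal (a * \<bar>u t\<bar>)) \<le> ennreal (b * \<bar>u t\<bar> * v0 t)"
        unfolding v0_eq using 1 by (rule chord_slope_young)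
      also have "b * \<bar>u t\<bar> * v0 t \<le> 1 * \<bar>u t\<bar> * v0 t"
        using b pos by (intro mult_right_mono) auto
      finally show ?thesis using pos by (simp add: ennreal_leI)
    qed
    \<comment> \<open>These sets increase to the whole space because \<open>h\<close> is positive.
      By monotone convergence the modular of \<open>a * u\<close> over \<open>A n\<close> grows to
      infinity, so it exceeds 1 for some \<open>n\<close>.\<close>
    define A where "A n = {t \<in> space M. \<bar>u t\<bar> * v0 t \<le> real n * h t}" for n
    have [measurable]: "A n \<in> sets M" for n unfolding A_def by measurable
    have "(SUP n. \<integral>\<^sup>+ t. \<Phi> t (ennreal (a * \<bar>u t\<bar>)) * indicator (A n) t \<partial>M)
        = (\<integral>\<^sup>+ t. (SUP n. \<Phi> t (ennreal (a * \<bar>u t\<bar>)) * indicator (A n) t) \<partial>M)"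
    proof (rule nn_integral_monotone_convergence_SUP[symmetric])
      show "incseq (\<lambda>n t. \<Phi> t (ennreal (a * \<bar>u t\<bar>)) * indicator (A n) t)"
      proof (intro incseq_SucI le_funI mult_left_mono)
        fix n t
        have "real n * h t \<le> real (Suc n) * h t" using h_nonneg[of t] by (intro mult_right_mono) auto
        then show "indicator (A n) t \<le> (indicator (A (Suc n)) t :: ennreal)"
          by (auto simp: A_def split: split_indicator)
      qed simp
    qed simp
    also have "\<dots> = (\<integral>\<^sup>+ t. \<Phi> t (ennreal (a * \<bar>u t\<bar>)) \<partial>M)"
    proof (rule nn_integral_cong)
      fix t assume t: "t \<in> space M"
      obtain n where "\<bar>u t\<bar> * v0 t < real n * h t" using reals_Archimedean3[OF h_pos[OF t]] by blast
      then have "t \<in> A n" using t by (simp add: A_def)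
      show "(SUP n. \<Phi> t (ennreal (a * \<bar>u t\<bar>)) * indicator (A n) t) = \<Phi> t (ennreal (a * \<bar>u t\<bar>))"
      proof (rule antisym)
        show "\<Phi> t (ennreal (a * \<bar>u t\<bar>)) \<le> (SUP n. \<Phi> t (ennreal (a * \<bar>u t\<bar>)) * indicator (A n) t)"
          using \<open>t \<in> A n\<close> by (intro SUP_upper2[of n]) auto
      qed (rule SUP_least, simp split: split_indicator)
    qed
    also have "\<dots> = top" using inf a by (simp add: modular_def abs_mult)
    finally have top: "(SUP n. \<integral>\<^sup>+ t. \<Phi> t (ennreal (a * \<bar>u t\<bar>)) * indicator (A n) t \<partial>M) = top" .
    have "1 < (SUP n. \<integral>\<^sup>+ t. \<Phi> t (ennreal (a * \<bar>u t\<bar>)) * indicator (A n) t \<partial>M)"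
      unfolding top by simp
    then obtain n where n: "1 < (\<integral>\<^sup>+ t. \<Phi> t (ennreal (a * \<bar>u t\<bar>)) * indicator (A n) t \<partial>M)"
      by (auto simp: less_SUP_iff)
    define v where "v t = v0 t * indicator (A n) t" for t
    have [measurable]: "v \<in> borel_measurable M" unfolding v_def by measurable
    show ?thesis
    proof (rule one_le_orlicz_norm)
      show "(\<integral>\<^sup>+ t. ennreal (\<bar>u t\<bar> * v t) \<partial>M) < top"
      proof -
        have "(\<integral>\<^sup>+ t. ennreal (\<bar>u t\<bar> * v t) \<partial>M) \<le> (\<integral>\<^sup>+ t. ennreal (real n) * ennreal (h t) \<partial>M)"
          using h_nonneg by (intro nn_integral_mono)
            (auto simp: v_def A_def simp flip: ennreal_mult split: split_indicator intro!: ennreal_leI)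
        also have "\<dots> < top" using h_fin by (simp add: nn_integral_cmult ennreal_mult_less_top)
        finally show ?thesis .
      qed
      have "(\<integral>\<^sup>+ t. complementary \<Phi> t (ennreal (v t)) \<partial>M) + 1
          \<le> (\<integral>\<^sup>+ t. complementary \<Phi> t (ennreal (v t)) \<partial>M)
            + (\<integral>\<^sup>+ t. \<Phi> t (ennreal (a * \<bar>u t\<bar>)) * indicator (A n) t \<partial>M)"
        using n by (intro add_left_mono) simp
      also have "\<dots> = (\<integral>\<^sup>+ t. complementary \<Phi> t (ennreal (v t))
            + \<Phi> t (ennreal (a * \<bar>u t\<bar>)) * indicator (A n) t \<partial>M)"
        by (simp add: nn_integral_add)
      also have "\<dots> \<le> (\<integral>\<^sup>+ t. ennreal (\<bar>u t\<bar> * v t) \<partial>M)"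
      proof (rule nn_integral_mono_AE)
        show "AE t in M. complementary \<Phi> t (ennreal (v t)) + \<Phi> t (ennreal (a * \<bar>u t\<bar>)) * indicator (A n) t
            \<le> ennreal (\<bar>u t\<bar> * v t)"
          using fin_AE by eventually_elim (use v0 in \<open>auto simp: v_def split: split_indicator\<close>)
      qed
      finally show "(\<integral>\<^sup>+ t. complementary \<Phi> t (ennreal (v t)) \<partial>M) + 1
          \<le> (\<integral>\<^sup>+ t. ennreal (\<bar>u t\<bar> * v t) \<partial>M)" .
    qed (use v0 in \<open>auto simp: v_def\<close>)
  qed
qed

lemma orlicz_norm_scale_le:
  assumes "0 < c"
  shows "ennreal c * orlicz_norm M \<Phi> (\<lambda>t. u t / c) \<le> orlicz_norm M \<Phi> u"
  unfolding orlicz_norm_def SUP_mult_left_ennreal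
proof (rule SUP_mono)
  fix v assume "v \<in> {v \<in> orlicz_class M (complementary \<Phi>). modular M (complementary \<Phi>) v \<le> 1}"
  moreover have "ennreal c * ennreal \<bar>LINT t|M. u t / c * v t\<bar> = ennreal \<bar>LINT t|M. u t * v t\<bar>"
    using assms by (simp add: flip: ennreal_mult)
  ultimately show "\<exists>w\<in>{v \<in> orlicz_class M (complementary \<Phi>). modular M (complementary \<Phi>) v \<le> 1}.
      ennreal c * ennreal \<bar>LINT t|M. u t / c * v t\<bar> \<le> ennreal \<bar>LINT t|M. u t * w t\<bar>"
    by (intro bexI[of _ v]) simp_all
qed

text \<open>For \<open>0 < r < s < theta M \<Phi> u\<close> the modular of \<open>u / s\<close> is
  infinite, and \<open>u / s\<close> is \<open>u / r\<close> multiplied by \<open>r / s < 1\<close>.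
  Hence \<open>u / r\<close> has Orlicz norm at least 1, and \<open>u\<close> has norm at least
  \<open>r\<close>.\<close>

lemma theta_le_orlicz_norm:
  assumes u: "u \<in> borel_measurable M"
  shows "theta M \<Phi> u \<le> orlicz_norm M \<Phi> u"
proof (rule dense_le)
  fix y assume y: "y < theta M \<Phi> u"
  then obtain y' where y': "y < y'" "y' < theta M \<Phi> u" using dense by blast
  then obtain s where s: "y' = ennreal s" "0 < s"
    using le_less_trans[OF zero_le y'(1)] by (cases y') auto
  from y'(1) s obtain r where r: "y = ennreal r" "0 \<le> r" "r < s"
    by (cases y) (auto simp: ennreal_less_iff)
  show "y \<le> orlicz_norm M \<Phi> u"
  proof (cases "r = 0")
    case False
    then have r0: "0 < r" using r by simp
    have "\<not> modular M \<Phi> (\<lambda>t. u t / s) < \<infinity>"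
    proof
      assume "modular M \<Phi> (\<lambda>t. u t / s) < \<infinity>"
      then have "theta M \<Phi> u \<le> ennreal s"
        unfolding theta_def using s by (intro INF_lower) auto
      with y'(2) s show False by simp
    qed
    then have "modular M \<Phi> (\<lambda>t. (r / s) * (u t / r)) = top"
      using r0 by (simp flip: less_top)
    then have "1 \<le> orlicz_norm M \<Phi> (\<lambda>t. u t / r)"
      using r0 r s u by (intro one_le_orlicz_norm_of_modular_infinite[of _ "r / s"]) auto
    then have "ennreal r * 1 \<le> ennreal r * orlicz_norm M \<Phi> (\<lambda>t. u t / r)"
      by (intro mult_left_mono) auto
    also have "\<dots> \<le> orlicz_norm M \<Phi> u" by (rule orlicz_norm_scale_le[OF r0])
    finally show ?thesis using r by simp
  qed (simp add: r)
qed

end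

subsection \<open>Singular functionals\<close>

locale orlicz_functional = regular_musielak_orlicz M \<Phi>
  for M :: "'a measure" and \<Phi> +
  fixes f :: "('a \<Rightarrow> real) \<Rightarrow> real"
  assumes dual: "f \<in> orlicz_dual M \<Phi>"
begin

lemma f_add: "u \<in> orlicz_space M \<Phi> \<Longrightarrow> v \<in> orlicz_space M \<Phi> \<Longrightarrow> f (\<lambda>t. u t + v t) = f u + f v"
  using dual by (simp add: orlicz_dual_def)

lemma f_scale: "u \<in> orlicz_space M \<Phi> \<Longrightarrow> f (\<lambda>t. c * u t) = c * f u"
  using dual by (simp add: orlicz_dual_def)

lemma f_diff:
  assumes "u \<in> orlicz_space M \<Phi>" "v \<in> orlicz_space M \<Phi>"
  shows "f (\<lambda>t. u t - v t) = f u - f v"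
  using f_add[OF assms(1) orlicz_space_scale[OF assms(2), of "-1"]] f_scale[OF assms(2), of "-1"] by simp

lemma f_bound:
  obtains C :: real where "\<And>u. u \<in> orlicz_space M \<Phi> \<Longrightarrow> ennreal \<bar>f u\<bar> \<le> ennreal C * luxemburg_norm M \<Phi> u"
  using dual unfolding orlicz_dual_def by blast

lemma orlicz_functional_uminus: "orlicz_functional M \<Phi> (\<lambda>u. - f u)"
  by unfold_locales (use dual in \<open>auto simp: orlicz_dual_def\<close>)

lemma f_AE_zero:
  assumes "u \<in> orlicz_space M \<Phi>" "AE t in M. u t = 0"
  shows "f u = 0"
proof -
  obtain C where "ennreal \<bar>f u\<bar> \<le> ennreal C * luxemburg_norm M \<Phi> u"
    using f_bound assms(1) by blast
  then show ?thesis by (simp add: luxemburg_norm_AE_zero[OF assms(2)])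
qed

lemma f_cong_AE:
  assumes "u \<in> orlicz_space M \<Phi>" "v \<in> orlicz_space M \<Phi>" "AE t in M. u t = v t"
  shows "f u = f v"
proof -
  have "f (\<lambda>t. u t - v t) = 0"
    by (rule f_AE_zero[OF orlicz_space_diff[OF assms(1,2)]]) (use assms(3) in auto)
  with f_diff[OF assms(1,2)] show ?thesis by simp
qed

section \<open>The positive part of a functional on the positive cone\<close>

abbreviation "in_cone u \<equiv> u \<in> orlicz_space M \<Phi> \<and> (AE t in M. 0 \<le> u t)"

lemma zero_in_orlicz_space [simp]: "(\<lambda>t. 0) \<in> orlicz_space M \<Phi>"
  by (auto simp: orlicz_space_def modular_def intro!: exI[of _ 1])

lemma AE_abs_le_of_bounds:
  fixes z u :: "'a \<Rightarrow> real"
  assumes "AE t in M. 0 \<le> z t \<and> z t \<le> u t"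
  shows "AE t in M. \<bar>z t\<bar> \<le> \<bar>u t\<bar>"
  using assms by (rule eventually_mono) auto

text \<open>The supremum is taken in the reals, so boundedness of \<open>f\<close> on the order
  interval must be shown first. It comes from norm boundedness and monotonicity of the Luxemburg
  norm.\<close>

lemma functional_pos_upper:
  assumes "u \<in> orlicz_space M \<Phi>" "w \<in> orlicz_space M \<Phi>" "AE t in M. 0 \<le> w t \<and> w t \<le> u t"
  shows "f w \<le> functional_pos M \<Phi> f u"
proof -
  obtain C where C: "\<And>u. u \<in> orlicz_space M \<Phi> \<Longrightarrow> ennreal \<bar>f u\<bar> \<le> ennreal C * luxemburg_norm M \<Phi> u"
    using f_bound by blast
  have fin: "ennreal C * luxemburg_norm M \<Phi> u < top"
    using luxemburg_norm_finite[OF assms(1)] by (simp add: ennreal_mult_less_top)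
  have "f z \<le> enn2real (ennreal C * luxemburg_norm M \<Phi> u)"
    if "z \<in> orlicz_space M \<Phi>" "AE t in M. 0 \<le> z t \<and> z t \<le> u t" for z
  proof -
    have "ennreal \<bar>f z\<bar> \<le> ennreal C * luxemburg_norm M \<Phi> z" using C that by blast
    also have "\<dots> \<le> ennreal C * luxemburg_norm M \<Phi> u"
      by (intro mult_left_mono luxemburg_norm_mono AE_abs_le_of_bounds that(2)) simp
    finally have "enn2real (ennreal \<bar>f z\<bar>) \<le> enn2real (ennreal C * luxemburg_norm M \<Phi> u)"
      using fin by (rule enn2real_mono)
    then show ?thesis by simp
  qed
  then have "bdd_above (f ` {w \<in> orlicz_space M \<Phi>. AE t in M. 0 \<le> w t \<and> w t \<le> u t})"
    by (auto intro!: bdd_aboveI2)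
  then show ?thesis
    unfolding functional_pos_def using assms by (intro cSUP_upper) auto
qed

lemma functional_pos_least:
  assumes "AE t in M. 0 \<le> u t"
    and "\<And>w. w \<in> orlicz_space M \<Phi> \<Longrightarrow> AE t in M. 0 \<le> w t \<and> w t \<le> u t \<Longrightarrow> f w \<le> c"
  shows "functional_pos M \<Phi> f u \<le> c"
proof -
  have "(\<lambda>t. 0) \<in> {w \<in> orlicz_space M \<Phi>. AE t in M. 0 \<le> w t \<and> w t \<le> u t}" using assms(1) by simp
  then show ?thesis
    unfolding functional_pos_def using assms(2) by (intro cSUP_least) blast+
qed

lemma functional_pos_zero: "functional_pos M \<Phi> f (\<lambda>t. 0) \<le> 0"
proof (rule functional_pos_least)
  fix w :: "'a \<Rightarrow> real" assume w: "w \<in> orlicz_space M \<Phi>" "AE t in M. 0 \<le> w t \<and> w t \<le> 0"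
  have "AE t in M. w t = 0" using w(2) by eventually_elim auto
  with f_AE_zero[OF w(1)] show "f w \<le> 0" by simp
qed simp

lemma functional_pos_nonneg:
  assumes "in_cone u"
  shows "0 \<le> functional_pos M \<Phi> f u"
  using functional_pos_upper[of u "\<lambda>t. 0"] f_AE_zero[of "\<lambda>t. 0"] assms by simp

lemma functional_pos_mono:
  assumes "u \<in> orlicz_space M \<Phi>" "v \<in> orlicz_space M \<Phi>" "AE t in M. 0 \<le> u t \<and> u t \<le> v t"
  shows "functional_pos M \<Phi> f u \<le> functional_pos M \<Phi> f v"
proof (rule functional_pos_least)
  fix w assume w: "w \<in> orlicz_space M \<Phi>" "AE t in M. 0 \<le> w t \<and> w t \<le> u t"
  have "AE t in M. 0 \<le> w t \<and> w t \<le> v t" using w(2) assms(3) by eventually_elim auto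
  then show "f w \<le> functional_pos M \<Phi> f v" by (intro functional_pos_upper assms w)
qed (use assms(3) in auto)

text \<open>Riesz decomposition: a function between 0 and \<open>a + b\<close> splits into its
  minimum with \<open>a\<close> and a remainder between 0 and \<open>b\<close>.\<close>

lemma functional_pos_subadditive:
  assumes a: "in_cone a" and b: "in_cone b"
  shows "functional_pos M \<Phi> f (\<lambda>t. a t + b t) \<le> functional_pos M \<Phi> f a + functional_pos M \<Phi> f b"
proof (rule functional_pos_least)
  show "AE t in M. 0 \<le> a t + b t" using a b by auto
  fix w assume w: "w \<in> orlicz_space M \<Phi>" "AE t in M. 0 \<le> w t \<and> w t \<le> a t + b t"
  have [measurable]: "a \<in> borel_measurable M" "w \<in> borel_measurable M"
    using a w by (auto simp: orlicz_space_def)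
  define w1 where "w1 t = min (w t) (a t)" for t
  have w1: "AE t in M. 0 \<le> w1 t \<and> w1 t \<le> a t" and w2: "AE t in M. 0 \<le> w t - w1 t \<and> w t - w1 t \<le> b t"
    using w(2) conjunct2[OF a] conjunct2[OF b] by (eventually_elim, auto simp: w1_def)+
  have w1_in: "w1 \<in> orlicz_space M \<Phi>"
    by (rule orlicz_space_dominated[OF conjunct1[OF a]]) (use w1 in \<open>auto simp: w1_def[abs_def]\<close>)
  have w2_in: "(\<lambda>t. w t - w1 t) \<in> orlicz_space M \<Phi>" by (intro orlicz_space_diff w w1_in)
  have "f w = f w1 + f (\<lambda>t. w t - w1 t)" using f_diff[OF w(1) w1_in] by simp
  also have "\<dots> \<le> functional_pos M \<Phi> f a + functional_pos M \<Phi> f b"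
    using a b by (intro add_mono functional_pos_upper w1 w2 w1_in w2_in) auto
  finally show "f w \<le> \<dots>" .
qed

text \<open>Adding \<open>w\<close> to a competitor for \<open>u - w\<close> gives a competitor for
  \<open>u\<close>. Thus the positive part is small on \<open>u - w\<close> whenever
  \<open>w\<close> nearly attains the supremum for \<open>u\<close>.\<close>

lemma functional_pos_diff_le:
  assumes u: "u \<in> orlicz_space M \<Phi>" and w: "w \<in> orlicz_space M \<Phi>" and le: "AE t in M. 0 \<le> w t \<and> w t \<le> u t"
  shows "functional_pos M \<Phi> f (\<lambda>t. u t - w t) \<le> functional_pos M \<Phi> f u - f w"
proof (rule functional_pos_least)
  fix z assume z: "z \<in> orlicz_space M \<Phi>" "AE t in M. 0 \<le> z t \<and> z t \<le> u t - w t"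
  have "AE t in M. 0 \<le> z t + w t \<and> z t + w t \<le> u t" using z(2) le by eventually_elim auto
  then have "f (\<lambda>t. z t + w t) \<le> functional_pos M \<Phi> f u"
    by (intro functional_pos_upper u orlicz_space_add z w)
  then show "f z \<le> functional_pos M \<Phi> f u - f w" using f_add[OF z(1) w] by simp
qed (use le in auto)

text \<open>The reflection of \<open>w\<close> to \<open>u - w\<close> maps the order interval below
  \<open>u\<close> to itself. This is the inequality needed from the decomposition of
  \<open>f\<close> into its positive and negative parts.\<close>

lemma functional_neg_le:
  assumes u: "u \<in> orlicz_space M \<Phi>" and pos: "AE t in M. 0 \<le> u t"
  shows "functional_neg M \<Phi> f u \<le> functional_pos M \<Phi> f u - f u"
  unfolding functional_neg_def
proof (rule orlicz_functional.functional_pos_least[OF orlicz_functional_uminus pos])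
  fix w assume w: "w \<in> orlicz_space M \<Phi>" "AE t in M. 0 \<le> w t \<and> w t \<le> u t"
  have "AE t in M. 0 \<le> u t - w t \<and> u t - w t \<le> u t" using w(2) by eventually_elim auto
  then have "f (\<lambda>t. u t - w t) \<le> functional_pos M \<Phi> f u"
    by (intro functional_pos_upper u orlicz_space_diff w)
  then show "- f w \<le> functional_pos M \<Phi> f u - f u" using f_diff[OF u w(1)] by simp
qed

section \<open>The order continuous component of the positive part\<close>

lemma increasing_seqs_AE:
  assumes "us \<in> increasing_seqs M u"
  shows "AE t in M. (\<forall>n. 0 \<le> us n t) \<and> incseq (\<lambda>n. us n t) \<and> (\<lambda>n. us n t) \<longlonglongrightarrow> u t"
  using assms unfolding increasing_seqs_def by blast

lemma increasing_seqs_bounds: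
  assumes u: "u \<in> orlicz_space M \<Phi>" and us: "us \<in> increasing_seqs M u"
  shows "us n \<in> orlicz_space M \<Phi>" "AE t in M. 0 \<le> us n t \<and> us n t \<le> u t"
proof -
  show *: "AE t in M. 0 \<le> us n t \<and> us n t \<le> u t"
    using increasing_seqs_AE[OF us] by eventually_elim (auto intro: incseq_le)
  show "us n \<in> orlicz_space M \<Phi>"
    by (rule orlicz_space_dominated[OF u]) (use us * in \<open>auto simp: increasing_seqs_def\<close>)
qed

text \<open>Shows that the real infimum in \<open>oc_component_pos\<close> runs over a nonempty set,
  and bounds it by the functional itself.\<close>

lemma const_increasing_seqs:
  assumes "in_cone u"
  shows "(\<lambda>n. u) \<in> increasing_seqs M u"
  using assms by (auto simp: increasing_seqs_def incseq_def orlicz_space_def)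

lemma bdd_above_functional_pos_seq:
  assumes u: "u \<in> orlicz_space M \<Phi>" and us: "us \<in> increasing_seqs M u"
  shows "bdd_above (range (\<lambda>n. functional_pos M \<Phi> f (us n)))"
  using increasing_seqs_bounds[OF u us] u
  by (intro bdd_aboveI2[of _ _ "functional_pos M \<Phi> f u"] functional_pos_mono)

lemma sup_functional_pos_seq_nonneg:
  assumes u: "u \<in> orlicz_space M \<Phi>" and us: "us \<in> increasing_seqs M u"
  shows "0 \<le> (SUP n. functional_pos M \<Phi> f (us n))"
proof -
  have "0 \<le> functional_pos M \<Phi> f (us 0)"
    using increasing_seqs_bounds[OF u us, of 0] by (intro functional_pos_nonneg) (auto elim!: eventually_mono)
  also have "\<dots> \<le> (SUP n. functional_pos M \<Phi> f (us n))"
    by (intro cSUP_upper bdd_above_functional_pos_seq[OF u us]) simp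
  finally show ?thesis .
qed

lemma oc_component_pos_le:
  assumes u: "u \<in> orlicz_space M \<Phi>" and us: "us \<in> increasing_seqs M u"
    and le: "\<And>n. functional_pos M \<Phi> f (us n) \<le> c"
  shows "oc_component_pos M (functional_pos M \<Phi> f) u \<le> c"
proof -
  have "oc_component_pos M (functional_pos M \<Phi> f) u \<le> (SUP n. functional_pos M \<Phi> f (us n))"
    unfolding oc_component_pos_def
    using us sup_functional_pos_seq_nonneg[OF u] by (intro cINF_lower bdd_belowI2[of _ 0])
  also have "\<dots> \<le> c" using le by (intro cSUP_least) auto
  finally show ?thesis .
qed

lemma oc_component_pos_le_functional_pos:
  assumes "in_cone u"
  shows "oc_component_pos M (functional_pos M \<Phi> f) u \<le> functional_pos M \<Phi> f u"
  using assms by (intro oc_component_pos_le[OF _ const_increasing_seqs]) auto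

lemma oc_component_pos_nonneg:
  assumes "in_cone u"
  shows "0 \<le> oc_component_pos M (functional_pos M \<Phi> f) u"
  unfolding oc_component_pos_def
  using assms const_increasing_seqs[OF assms] sup_functional_pos_seq_nonneg
  by (intro cINF_greatest) auto

lemma oc_component_pos_approx:
  assumes u: "in_cone u" and less: "oc_component_pos M (functional_pos M \<Phi> f) u < c"
  obtains us where "us \<in> increasing_seqs M u" "\<And>n. functional_pos M \<Phi> f (us n) < c"
proof -
  have "\<exists>x\<in>(\<lambda>us. SUP n. functional_pos M \<Phi> f (us n)) ` increasing_seqs M u. x < c"
    using less const_increasing_seqs[OF u] unfolding oc_component_pos_def
    by (intro cInf_lessD) auto
  then obtain us where us: "us \<in> increasing_seqs M u" "(SUP n. functional_pos M \<Phi> f (us n)) < c" by auto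
  have "functional_pos M \<Phi> f (us n) \<le> (SUP n. functional_pos M \<Phi> f (us n))" for n
    using u us(1) by (intro cSUP_upper bdd_above_functional_pos_seq[of u]) auto
  with us show thesis by (meson le_less_trans that)
qed

text \<open>Adding nearly optimal sequences for \<open>a\<close> and \<open>b\<close> gives a
  sequence increasing to \<open>a + b\<close>, on which the positive part is subadditive.\<close>

lemma oc_component_pos_subadditive:
  assumes a: "in_cone a" and b: "in_cone b"
  shows "oc_component_pos M (functional_pos M \<Phi> f) (\<lambda>t. a t + b t)
    \<le> oc_component_pos M (functional_pos M \<Phi> f) a + oc_component_pos M (functional_pos M \<Phi> f) b"
    (is "?c (\<lambda>t. a t + b t) \<le> ?c a + ?c b")
proof (rule field_le_epsilon)
  fix e :: real assume e: "0 < e"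
  obtain us where us: "us \<in> increasing_seqs M a" "\<And>n. functional_pos M \<Phi> f (us n) < ?c a + e / 2"
    using e by (rule_tac oc_component_pos_approx[OF a, of "?c a + e / 2"]) auto
  obtain vs where vs: "vs \<in> increasing_seqs M b" "\<And>n. functional_pos M \<Phi> f (vs n) < ?c b + e / 2"
    using e by (rule_tac oc_component_pos_approx[OF b, of "?c b + e / 2"]) auto
  show "?c (\<lambda>t. a t + b t) \<le> ?c a + ?c b + e"
  proof (rule oc_component_pos_le)
    show "(\<lambda>t. a t + b t) \<in> orlicz_space M \<Phi>" using a b by (intro orlicz_space_add) auto
    have "AE t in M. (\<forall>n. 0 \<le> us n t + vs n t) \<and> incseq (\<lambda>n. us n t + vs n t) \<and> (\<lambda>n. us n t + vs n t) \<longlonglongrightarrow> a t + b t"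
      using increasing_seqs_AE[OF us(1)] increasing_seqs_AE[OF vs(1)]
      by eventually_elim (auto simp: incseq_def intro!: add_mono tendsto_add)
    then show "(\<lambda>n t. us n t + vs n t) \<in> increasing_seqs M (\<lambda>t. a t + b t)"
      using us(1) vs(1) unfolding increasing_seqs_def by (blast intro: borel_measurable_add)
    fix n
    have "functional_pos M \<Phi> f (\<lambda>t. us n t + vs n t) \<le> functional_pos M \<Phi> f (us n) + functional_pos M \<Phi> f (vs n)"
      using increasing_seqs_bounds[OF conjunct1[OF a] us(1), of n] increasing_seqs_bounds[OF conjunct1[OF b] vs(1), of n]
      by (intro functional_pos_subadditive) (auto elim!: eventually_mono)
    also have "\<dots> \<le> ?c a + ?c b + e" using us(2)[of n] vs(2)[of n] by simp
    finally show "functional_pos M \<Phi> f (\<lambda>t. us n t + vs n t) \<le> ?c a + ?c b + e" .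
  qed
qed

end

section \<open>Consequences of pure singularity\<close>

locale singular_functional = orlicz_functional +
  assumes singular: "purely_singular M \<Phi> f"
begin

sublocale uminus: orlicz_functional M \<Phi> "\<lambda>u. - f u"
  by (rule orlicz_functional_uminus)

abbreviation "oc_pos \<equiv> oc_component_pos M (functional_pos M \<Phi> f)"
abbreviation "oc_neg \<equiv> oc_component_pos M (functional_neg M \<Phi> f)"

text \<open>For nonnegative \<open>u\<close> only the difference of the two components remains in
  \<open>oc_component\<close>, so pure singularity by definition gives their equality. That both
  vanish is a separate step.\<close>

lemma oc_pos_eq_oc_neg:
  assumes u: "u \<in> orlicz_space M \<Phi>" and pos: "\<And>t. 0 \<le> u t"
  shows "oc_pos u = oc_neg u"
proof -
  have zero: "in_cone (\<lambda>t. 0)" by simp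
  have "oc_pos (\<lambda>t. 0) = 0" "oc_neg (\<lambda>t. 0) = 0"
    using oc_component_pos_nonneg[OF zero] oc_component_pos_le_functional_pos[OF zero] functional_pos_zero
      uminus.oc_component_pos_nonneg[OF zero] uminus.oc_component_pos_le_functional_pos[OF zero] uminus.functional_pos_zero
    unfolding functional_neg_def by linarith+
  moreover have "oc_component M \<Phi> f u = 0" using singular u by (simp add: purely_singular_def)
  moreover have "(\<lambda>t. max (u t) 0) = u" "(\<lambda>t. max (- u t) 0) = (\<lambda>t. 0)" using pos by (auto simp: max_def fun_eq_iff intro: antisym)
  ultimately show ?thesis by (simp add: oc_component_def)
qed

text \<open>The in_cone and the negative part of \<open>f\<close> are disjoint, so \<open>u = w + (u - w)\<close> with the negative
  part small on \<open>w\<close> and the positive part small on \<open>u - w\<close>; hence their order continuous components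
  cannot coincide without vanishing.\<close>

lemma oc_pos_zero:
  assumes u: "u \<in> orlicz_space M \<Phi>" and pos: "\<And>t. 0 \<le> u t"
  shows "oc_pos u = 0"
proof (rule antisym)
  show "oc_pos u \<le> 0"
  proof (rule field_le_epsilon)
    fix e :: real assume e: "0 < e"
    have "\<not> functional_pos M \<Phi> f u \<le> functional_pos M \<Phi> f u - e / 2" using e by simp
    then obtain w0 where w0: "w0 \<in> orlicz_space M \<Phi>" "AE t in M. 0 \<le> w0 t \<and> w0 t \<le> u t"
        "functional_pos M \<Phi> f u - e / 2 < f w0"
      using functional_pos_least[of u "functional_pos M \<Phi> f u - e / 2"] pos by (meson AE_I2 not_le)
    have [measurable]: "u \<in> borel_measurable M" "w0 \<in> borel_measurable M"
      using u w0 by (auto simp: orlicz_space_def)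
    \<comment> \<open>A modification of \<open>w0\<close> on a null set, so that the bounds hold at
      every point.\<close>
    define w where "w t = max 0 (min (w0 t) (u t))" for t
    have w: "0 \<le> w t" "w t \<le> u t" for t using pos[of t] by (auto simp: w_def)
    have w_in: "w \<in> orlicz_space M \<Phi>"
      by (rule orlicz_space_dominated[OF u]) (use w pos in \<open>auto simp: w_def[abs_def]\<close>)
    have "AE t in M. w t = w0 t" using w0(2) by eventually_elim (auto simp: w_def)
    then have fw: "f w = f w0" by (intro f_cong_AE w_in w0)
    have uw_in: "(\<lambda>t. u t - w t) \<in> orlicz_space M \<Phi>" by (intro orlicz_space_diff u w_in)
    \<comment> \<open>Both summands end up at most \<open>functional_pos M \<Phi> f u - f w\<close>,
      which is below \<open>e / 2\<close>. For \<open>w\<close> the component is first exchanged for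
      that of the negative part.\<close>
    have "oc_pos u = oc_pos (\<lambda>t. w t + (u t - w t))" by simp
    also have "\<dots> \<le> oc_pos w + oc_pos (\<lambda>t. u t - w t)"
      using w w_in uw_in by (intro oc_component_pos_subadditive) auto
    also have "oc_pos w = oc_neg w" using w w_in by (intro oc_pos_eq_oc_neg)
    also have "oc_neg w \<le> functional_neg M \<Phi> f w"
      unfolding functional_neg_def using w w_in by (intro uminus.oc_component_pos_le_functional_pos) auto
    also have "\<dots> \<le> functional_pos M \<Phi> f w - f w" using w w_in by (intro functional_neg_le) auto
    also have "functional_pos M \<Phi> f w \<le> functional_pos M \<Phi> f u"
      using w w_in u by (intro functional_pos_mono) auto
    also have "oc_pos (\<lambda>t. u t - w t) \<le> functional_pos M \<Phi> f (\<lambda>t. u t - w t)"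
      using w uw_in by (intro oc_component_pos_le_functional_pos) auto
    also have "functional_pos M \<Phi> f (\<lambda>t. u t - w t) \<le> functional_pos M \<Phi> f u - f w"
      using w w_in u by (intro functional_pos_diff_le) auto
    finally show "oc_pos u \<le> 0 + e" using w0(3) fw by simp
  qed
  show "0 \<le> oc_pos u" using u pos by (intro oc_component_pos_nonneg) auto
qed

text \<open>Both components vanish, so there are sequences increasing to \<open>u\<close> on which
  the positive and the negative part of \<open>f\<close> stay below \<open>e / 2\<close>. Their
  pointwise minimum serves both, and \<open>z\<close> is split into its own positive and negative
  parts, costing \<open>e / 2\<close> each.\<close>

lemma exists_increasing_seq_small:
  assumes u: "u \<in> orlicz_space M \<Phi>" and pos: "\<And>t. 0 \<le> u t" and e: "0 < e"
  obtains ys where "ys \<in> increasing_seqs M u"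
    "\<And>n z. z \<in> borel_measurable M \<Longrightarrow> AE t in M. \<bar>z t\<bar> \<le> ys n t \<Longrightarrow> \<bar>f z\<bar> \<le> e"
proof -
  have u': "in_cone u" using u pos by simp
  have "oc_pos u < e / 2" "oc_neg u < e / 2"
    using oc_pos_zero[OF u pos] oc_pos_eq_oc_neg[OF u pos] e by auto
  then obtain us vs where us: "us \<in> increasing_seqs M u" "\<And>n. functional_pos M \<Phi> f (us n) < e / 2"
    and vs: "vs \<in> increasing_seqs M u" "\<And>n. functional_pos M \<Phi> (\<lambda>u. - f u) (vs n) < e / 2"
    using oc_component_pos_approx[OF u'] uminus.oc_component_pos_approx[OF u'] unfolding functional_neg_def
    by metis
  define ys where "ys n t = min (us n t) (vs n t)" for n t
  have "AE t in M. (\<forall>n. 0 \<le> ys n t) \<and> incseq (\<lambda>n. ys n t) \<and> (\<lambda>n. ys n t) \<longlonglongrightarrow> u t"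
    using increasing_seqs_AE[OF us(1)] increasing_seqs_AE[OF vs(1)]
  proof eventually_elim
    case (elim t)
    have "incseq (\<lambda>n. ys n t)" using elim unfolding incseq_def ys_def by (meson min.mono)
    moreover have "(\<lambda>n. ys n t) \<longlonglongrightarrow> min (u t) (u t)"
      unfolding ys_def using elim by (intro tendsto_min) auto
    ultimately show ?case using elim by (simp add: ys_def)
  qed
  moreover have ys_meas [measurable]: "ys n \<in> borel_measurable M" for n
    using us(1) vs(1) unfolding increasing_seqs_def ys_def[abs_def] by (intro borel_measurable_min) blast+
  ultimately have ys: "ys \<in> increasing_seqs M u" by (simp add: increasing_seqs_def)
  show thesis
  proof (rule that[OF ys])
    fix n z assume z [measurable]: "z \<in> borel_measurable M" and le: "AE t in M. \<bar>z t\<bar> \<le> ys n t"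
    have small: "\<bar>f x\<bar> \<le> e / 2" if x [measurable]: "x \<in> borel_measurable M" and xy: "AE t in M. 0 \<le> x t \<and> x t \<le> ys n t" for x
    proof -
      have x1: "AE t in M. 0 \<le> x t \<and> x t \<le> us n t" and x2: "AE t in M. 0 \<le> x t \<and> x t \<le> vs n t"
        using xy by (eventually_elim, simp add: ys_def)+
      have us_in: "us n \<in> orlicz_space M \<Phi>" and vs_in: "vs n \<in> orlicz_space M \<Phi>"
        using increasing_seqs_bounds[OF u] us vs by auto
      have x_in: "x \<in> orlicz_space M \<Phi>"
        by (rule orlicz_space_dominated[OF us_in x]) (use x1 in eventually_elim, auto)
      have "f x < e / 2" using functional_pos_upper[OF us_in x_in x1] us(2)[of n] by simp
      moreover have "- f x < e / 2" using uminus.functional_pos_upper[OF vs_in x_in x2] vs(2)[of n] by simp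
      ultimately show ?thesis by linarith
    qed
    have in_space: "x \<in> orlicz_space M \<Phi>" if "x \<in> borel_measurable M" "AE t in M. \<bar>x t\<bar> \<le> ys n t" for x
      using increasing_seqs_bounds[OF u ys, of n] that by (intro orlicz_space_dominated[of "ys n" x]) (auto elim!: eventually_mono)
    have z1: "AE t in M. 0 \<le> max (z t) 0 \<and> max (z t) 0 \<le> ys n t" and z2: "AE t in M. 0 \<le> max (- z t) 0 \<and> max (- z t) 0 \<le> ys n t"
      using le by (eventually_elim, auto)+
    have "f z = f (\<lambda>t. max (z t) 0 - max (- z t) 0)"
      by (rule arg_cong[where f = f]) (auto simp: max_def)
    also have "\<dots> = f (\<lambda>t. max (z t) 0) - f (\<lambda>t. max (- z t) 0)"
      using z1 z2 by (intro f_diff in_space) (auto elim!: eventually_mono)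
    finally have "\<bar>f z\<bar> \<le> \<bar>f (\<lambda>t. max (z t) 0)\<bar> + \<bar>f (\<lambda>t. max (- z t) 0)\<bar>" by simp
    moreover have "\<bar>f (\<lambda>t. max (z t) 0)\<bar> \<le> e / 2" "\<bar>f (\<lambda>t. max (- z t) 0)\<bar> \<le> e / 2"
      by (rule small[OF _ z1], simp, rule small[OF _ z2], simp)
    ultimately show "\<bar>f z\<bar> \<le> e" by simp
  qed
qed

text \<open>Stated for an abstract \<open>N\<close> so that it applies to the Luxemburg and to the
  Orlicz norm; of \<open>N\<close> only the bound on \<open>f\<close> and invariance under signs are
  used.\<close>

lemma abs_le_sup_null_seqs:
  assumes u: "u \<in> orlicz_space M \<Phi>"
    and bound: "\<And>w. w \<in> orlicz_space M \<Phi> \<Longrightarrow> ennreal \<bar>f w\<bar> \<le> D * N w" and D: "D < top"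
    and sign: "\<And>s w. s \<in> borel_measurable M \<Longrightarrow> (\<And>t. \<bar>s t\<bar> = 1) \<Longrightarrow> N (\<lambda>t. s t * w t) = N w"
  shows "ennreal \<bar>f u\<bar> \<le> D * (SUP us\<in>null_seqs M u. INF n. N (us n))"
proof (rule ennreal_le_epsilon)
  fix e :: real assume e: "0 < e"
  have [measurable]: "u \<in> borel_measurable M" using u by (simp add: orlicz_space_def)
  have abs_u: "(\<lambda>t. \<bar>u t\<bar>) \<in> orlicz_space M \<Phi>" by (rule orlicz_space_dominated[OF u]) auto
  obtain ys where ys: "ys \<in> increasing_seqs M (\<lambda>t. \<bar>u t\<bar>)"
    and small: "\<And>n z. z \<in> borel_measurable M \<Longrightarrow> AE t in M. \<bar>z t\<bar> \<le> ys n t \<Longrightarrow> \<bar>f z\<bar> \<le> e"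
    using exists_increasing_seq_small[OF abs_u _ e] by auto
  have [measurable]: "ys n \<in> borel_measurable M" for n using ys by (simp add: increasing_seqs_def)
  have ys_in: "ys n \<in> orlicz_space M \<Phi>" and ys_le: "AE t in M. 0 \<le> ys n t \<and> ys n t \<le> \<bar>u t\<bar>" for n
    using increasing_seqs_bounds[OF abs_u ys] by auto
  define s :: "'a \<Rightarrow> real" where "s t = (if u t < 0 then -1 else 1)" for t
  have [measurable]: "s \<in> borel_measurable M" unfolding s_def by measurable
  have s: "\<bar>s t\<bar> = 1" "u t = s t * \<bar>u t\<bar>" for t by (auto simp: s_def)
  define ws where "ws n t = \<bar>u t\<bar> - ys n t" for n t
  have "AE t in M. (\<forall>n. 0 \<le> ws n t \<and> ws n t \<le> \<bar>u t\<bar>) \<and> decseq (\<lambda>n. ws n t) \<and> (\<lambda>n. ws n t) \<longlonglongrightarrow> 0"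
  proof -
    show ?thesis using increasing_seqs_AE[OF ys]
    proof eventually_elim
      case (elim t)
      then have "ys n t \<le> \<bar>u t\<bar>" for n by (auto intro: incseq_le)
      moreover have "(\<lambda>n. ws n t) \<longlonglongrightarrow> \<bar>u t\<bar> - \<bar>u t\<bar>"
        unfolding ws_def using elim by (intro tendsto_diff tendsto_const) auto
      ultimately show ?case using elim by (auto simp: ws_def incseq_def decseq_def)
    qed
  qed
  then have ws: "ws \<in> null_seqs M u" by (simp add: null_seqs_def ws_def[abs_def])
  have step: "ennreal \<bar>f u\<bar> \<le> D * N (ws n) + ennreal e" for n
  proof -
    have "AE t in M. \<bar>s t * ws n t\<bar> \<le> \<bar>u t\<bar>"
      using ys_le[of n] by eventually_elim (simp add: ws_def abs_mult s(1))
    then have ws_in: "(\<lambda>t. s t * ws n t) \<in> orlicz_space M \<Phi>"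
      by (rule orlicz_space_dominated[OF u, rotated]) (simp add: ws_def[abs_def])
    have sy_in: "(\<lambda>t. s t * ys n t) \<in> orlicz_space M \<Phi>"
      by (rule orlicz_space_dominated[OF ys_in]) (auto simp: abs_mult s(1))
    have "u = (\<lambda>t. s t * ws n t + s t * ys n t)"
      using s(2) by (auto simp: ws_def fun_eq_iff simp flip: distrib_left)
    then have "f u = f (\<lambda>t. s t * ws n t) + f (\<lambda>t. s t * ys n t)" using f_add[OF ws_in sy_in] by simp
    moreover have "\<bar>f (\<lambda>t. s t * ys n t)\<bar> \<le> e"
      using ys_le[of n] by (intro small[of _ n]) (auto simp: abs_mult s(1) elim!: eventually_mono)
    ultimately have "\<bar>f u\<bar> \<le> \<bar>f (\<lambda>t. s t * ws n t)\<bar> + e" by linarith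
    then have "ennreal \<bar>f u\<bar> \<le> ennreal \<bar>f (\<lambda>t. s t * ws n t)\<bar> + ennreal e"
      using e by (simp flip: ennreal_plus)
    also have "\<dots> \<le> D * N (\<lambda>t. s t * ws n t) + ennreal e" by (intro add_right_mono bound ws_in)
    also have "N (\<lambda>t. s t * ws n t) = N (ws n)" using s by (intro sign) auto
    finally show ?thesis .
  qed
  have "ennreal \<bar>f u\<bar> - ennreal e \<le> D * (INF n. N (ws n))"
  \<comment> \<open>The factor \<open>D\<close> is moved past the infimum by dividing by it, which
    requires \<open>D\<close> to be nonzero and finite.\<close>
  proof (cases "D = 0")
    case True
    then show ?thesis using step[of 0] by (simp add: diff_eq_0_ennreal)
  next
    case False
    have "(ennreal \<bar>f u\<bar> - ennreal e) / D \<le> (INF n. N (ws n))"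
      using False step
      by (intro INF_greatest divide_le_posI_ennreal) (auto simp: ennreal_minus_le_iff add.commute zero_less_iff_neq_zero)
    then have "D * ((ennreal \<bar>f u\<bar> - ennreal e) / D) \<le> D * (INF n. N (ws n))"
      by (rule mult_left_mono) simp
    then show ?thesis using False D
      by (simp add: ennreal_times_divide mult.commute[of D] ennreal_mult_divide_eq)
  qed
  also have "\<dots> \<le> D * (SUP us\<in>null_seqs M u. INF n. N (us n))"
    by (intro mult_left_mono SUP_upper ws) simp
  finally show "ennreal \<bar>f u\<bar> \<le> D * (SUP us\<in>null_seqs M u. INF n. N (us n)) + ennreal e"
    by (simp add: ennreal_minus_le_iff add.commute)
qed

end

subsection \<open>The dual norms\<close>

lemma ennreal_divide_le_of_le_mult:
  fixes x q D :: ennreal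
  assumes "x \<le> D * q"
  shows "x / q \<le> D"
proof (cases "q = 0 \<or> q = top")
  case True
  then show ?thesis using assms by auto
next
  case False
  then show ?thesis using assms
    by (intro divide_le_posI_ennreal) (auto simp: mult.commute zero_less_iff_neq_zero)
qed

text \<open>Finiteness of \<open>D\<close> handles \<open>q = 0\<close>: a nonzero \<open>x\<close>
  would have an infinite quotient.\<close>

lemma ennreal_le_mult_of_divide_le:
  fixes x q D :: ennreal
  assumes "x / q \<le> D" "D < top" "q < top"
  shows "x \<le> D * q"
proof (cases "q = 0")
  case True
  then show ?thesis using assms by (auto split: if_splits)
next
  case False
  then have "x = (x / q) * q"
    using assms(3) by (simp add: ennreal_divide_times)
  also have "\<dots> \<le> D * q" using assms(1) by (rule mult_right_mono) simp
  finally show ?thesis .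
qed

lemma ennreal_divide_antimono:
  fixes x a b :: ennreal
  assumes "a \<le> b"
  shows "x / b \<le> x / a"
proof (cases "a = 0 \<or> a = top")
  case True
  then show ?thesis using assms by (auto simp: top_unique)
next
  case False
  then have "x = (x / a) * a" by (simp add: ennreal_divide_times less_top)
  also have "\<dots> \<le> (x / a) * b" using assms by (rule mult_left_mono) simp
  finally show ?thesis by (rule ennreal_divide_le_of_le_mult)
qed

section \<open>Suprema of quotients and the four expressions for the dual norm\<close>

lemma sup_quotient_antimono:
  assumes "S \<subseteq> T" "\<And>u. u \<in> S \<Longrightarrow> q u \<le> r u"
  shows "sup_quotient S f r \<le> sup_quotient T f q"
  unfolding sup_quotient_def using assms by (intro SUP_mono) (auto intro: ennreal_divide_antimono)

lemma sup_quotient_le: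
  assumes "\<And>u. u \<in> S \<Longrightarrow> ennreal \<bar>f u\<bar> \<le> D * q u"
  shows "sup_quotient S f q \<le> D"
  unfolding sup_quotient_def using assms by (intro SUP_least ennreal_divide_le_of_le_mult)

lemma (in orlicz_functional) dual_norm0_finite: "dual_norm0 M \<Phi> f < top"
proof -
  obtain C where "\<And>u. u \<in> orlicz_space M \<Phi> \<Longrightarrow> ennreal \<bar>f u\<bar> \<le> ennreal C * luxemburg_norm M \<Phi> u"
    using f_bound by blast
  then have "dual_norm0 M \<Phi> f \<le> ennreal C"
    unfolding dual_norm0_def by (intro sup_quotient_le) (auto simp: nonzero_orlicz_def)
  then show ?thesis by (simp add: le_less_trans)
qed

text \<open>Extends the dual norm bound from \<open>nonzero_orlicz\<close> to the whole space:
  \<open>f\<close> vanishes on functions that are zero almost everywhere.\<close>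

lemma (in orlicz_functional) abs_le_sup_quotient_mult:
  assumes "sup_quotient (nonzero_orlicz M \<Phi>) f q < top" "w \<in> orlicz_space M \<Phi>" "q w < top"
  shows "ennreal \<bar>f w\<bar> \<le> sup_quotient (nonzero_orlicz M \<Phi>) f q * q w"
proof (cases "AE t in M. w t = 0")
  case True
  then show ?thesis using f_AE_zero[OF assms(2)] by simp
next
  case False
  then have "ennreal \<bar>f w\<bar> / q w \<le> sup_quotient (nonzero_orlicz M \<Phi>) f q"
    unfolding sup_quotient_def using assms by (intro SUP_upper) (simp add: nonzero_orlicz_def)
  then show ?thesis using assms by (intro ennreal_le_mult_of_divide_le)
qed

text \<open>A matter of scaling: functions in the class have \<open>theta\<close> at most 1, and
  conversely \<open>u / l\<close> lies in the class for every \<open>l\<close> admissible in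
  \<open>theta M \<Phi> u\<close>.\<close>

lemma (in orlicz_functional) sup_orlicz_class_eq_sup_quotient_theta:
  "(SUP u\<in>orlicz_class M \<Phi>. ennreal \<bar>f u\<bar>) = sup_quotient (orlicz_space M \<Phi>) f (theta M \<Phi>)"
proof (rule antisym)
  show "(SUP u\<in>orlicz_class M \<Phi>. ennreal \<bar>f u\<bar>) \<le> sup_quotient (orlicz_space M \<Phi>) f (theta M \<Phi>)"
    unfolding sup_quotient_def
  proof (rule SUP_mono)
    fix u assume u: "u \<in> orlicz_class M \<Phi>"
    then have u_in: "u \<in> orlicz_space M \<Phi>"
      by (auto simp: orlicz_class_def orlicz_space_def intro!: exI[of _ 1])
    have "theta M \<Phi> u \<le> ennreal 1"
      unfolding theta_def using u by (intro INF_lower) (simp add: orlicz_class_def)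
    then have "ennreal \<bar>f u\<bar> / 1 \<le> ennreal \<bar>f u\<bar> / theta M \<Phi> u"
      by (intro ennreal_divide_antimono) simp
    then show "\<exists>w\<in>orlicz_space M \<Phi>. ennreal \<bar>f u\<bar> \<le> ennreal \<bar>f w\<bar> / theta M \<Phi> w"
      using u_in by (auto simp: divide_ennreal_def)
  qed
  define S where "S = (SUP u\<in>orlicz_class M \<Phi>. ennreal \<bar>f u\<bar>)"
  have "sup_quotient (orlicz_space M \<Phi>) f (theta M \<Phi>) \<le> S"
  proof (cases "S = top")
    case False
    show ?thesis
    proof (rule sup_quotient_le)
      fix u assume u: "u \<in> orlicz_space M \<Phi>"
      have step: "ennreal \<bar>f u\<bar> \<le> S * ennreal l" if l: "0 < l" "modular M \<Phi> (\<lambda>t. u t / l) < \<infinity>" for l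
      proof -
        have "(\<lambda>t. (1 / l) * u t) \<in> orlicz_class M \<Phi>"
          using u l by (auto simp: orlicz_class_def orlicz_space_def)
        then have "ennreal \<bar>f (\<lambda>t. (1 / l) * u t)\<bar> \<le> S" unfolding S_def by (rule SUP_upper)
        then have "ennreal \<bar>f (\<lambda>t. (1 / l) * u t)\<bar> * ennreal l \<le> S * ennreal l"
          by (rule mult_right_mono) simp
        then show ?thesis using f_scale[OF u, of "1 / l"] l(1) by (simp add: abs_mult flip: ennreal_mult)
      qed
      show "ennreal \<bar>f u\<bar> \<le> S * theta M \<Phi> u"
      proof (cases "S = 0")
        case True
        then show ?thesis using orlicz_space_divide_modular[OF u] step by (metis mult_zero_left)
      next
        case S0: False
        have "ennreal \<bar>f u\<bar> / S \<le> theta M \<Phi> u"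
          unfolding theta_def using step S0
          by (intro INF_greatest divide_le_posI_ennreal) (auto simp: zero_less_iff_neq_zero)
        then have "ennreal \<bar>f u\<bar> / S * S \<le> theta M \<Phi> u * S" by (rule mult_right_mono) simp
        moreover have "ennreal \<bar>f u\<bar> / S * S = ennreal \<bar>f u\<bar>"
          using S0 False by (simp add: ennreal_divide_times less_top)
        ultimately show ?thesis by (simp add: mult.commute)
      qed
    qed
  qed simp
  then show "sup_quotient (orlicz_space M \<Phi>) f (theta M \<Phi>) \<le> (SUP u\<in>orlicz_class M \<Phi>. ennreal \<bar>f u\<bar>)"
    by (simp add: S_def)
qed

theorem (in singular_functional) singular_norms:
  shows "dual_norm0 M \<Phi> f = sup_quotient (orlicz_space M \<Phi>) f (Q_lux M \<Phi>)"
    and "dual_norm M \<Phi> f = sup_quotient (orlicz_space M \<Phi>) f (Q_orl M \<Phi>)"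
    and "dual_norm0 M \<Phi> f = dual_norm M \<Phi> f"
    and "dual_norm M \<Phi> f = sup_quotient (orlicz_space M \<Phi>) f (theta M \<Phi>)"
proof -
  let ?T = "sup_quotient (orlicz_space M \<Phi>) f (theta M \<Phi>)"
  let ?QL = "sup_quotient (orlicz_space M \<Phi>) f (Q_lux M \<Phi>)"
  let ?QO = "sup_quotient (orlicz_space M \<Phi>) f (Q_orl M \<Phi>)"
  have "dual_norm0 M \<Phi> f \<le> ?T"
    unfolding dual_norm0_def
    by (rule sup_quotient_antimono) (auto simp: nonzero_orlicz_def theta_le_luxemburg_norm)
  moreover have "?T \<le> ?QL"
    by (rule sup_quotient_antimono) (auto simp: orlicz_space_def intro: Q_lux_le_theta)
  moreover have "?QL \<le> dual_norm0 M \<Phi> f"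
  proof (rule sup_quotient_le)
    fix u assume u: "u \<in> orlicz_space M \<Phi>"
    show "ennreal \<bar>f u\<bar> \<le> dual_norm0 M \<Phi> f * Q_lux M \<Phi> u"
      unfolding Q_lux_def
    proof (rule abs_le_sup_null_seqs[OF u])
      show "luxemburg_norm M \<Phi> (\<lambda>t. s t * w t) = luxemburg_norm M \<Phi> w" if "\<And>t. \<bar>s t\<bar> = 1" for s w
        using that by (intro antisym luxemburg_norm_mono) (auto simp: abs_mult)
    qed (use dual_norm0_finite luxemburg_norm_finite abs_le_sup_quotient_mult in \<open>auto simp: dual_norm0_def\<close>)
  qed
  ultimately have lux: "dual_norm0 M \<Phi> f = ?T" "dual_norm0 M \<Phi> f = ?QL" by auto
  have "dual_norm M \<Phi> f \<le> ?T"
    unfolding dual_norm_def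
    by (rule sup_quotient_antimono) (auto simp: nonzero_orlicz_def orlicz_space_def intro: theta_le_orlicz_norm)
  \<comment> \<open>The functional is bounded by definition in the Luxemburg norm only, so
    finiteness of the other dual norm is obtained through the common bound
    \<open>?T\<close>.\<close>
  moreover from this have fin: "dual_norm M \<Phi> f < top"
    using dual_norm0_finite lux by simp
  moreover have "?T \<le> ?QO"
    by (rule sup_quotient_antimono) (auto simp: orlicz_space_def intro: Q_orl_le_theta)
  moreover have "?QO \<le> dual_norm M \<Phi> f"
  proof (rule sup_quotient_le)
    fix u assume u: "u \<in> orlicz_space M \<Phi>"
    show "ennreal \<bar>f u\<bar> \<le> dual_norm M \<Phi> f * Q_orl M \<Phi> u"
      unfolding Q_orl_def
      by (rule abs_le_sup_null_seqs[OF u])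
        (use fin orlicz_norm_finite abs_le_sup_quotient_mult orlicz_norm_sign in \<open>auto simp: dual_norm_def\<close>)
  qed
  ultimately have orl: "dual_norm M \<Phi> f = ?T" "dual_norm M \<Phi> f = ?QO" by auto
  show "dual_norm0 M \<Phi> f = ?QL" "dual_norm M \<Phi> f = ?QO" "dual_norm0 M \<Phi> f = dual_norm M \<Phi> f"
    "dual_norm M \<Phi> f = ?T"
    using lux orl by simp_all
qed

section \<open>Removal of the exceptional null set\<close>

lemma regular_version:
  assumes "sigma_finite_measure M" "musielak_orlicz M \<Phi>"
  obtains \<Psi> where "regular_musielak_orlicz M \<Psi>" "AE t in M. \<Psi> t = \<Phi> t"
proof -
  have good: "AE t in M. convex_enn (\<Phi> t) \<and> lower_semicont (\<Phi> t) \<and>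
        \<Phi> t 0 = 0 \<and> (\<Phi> t \<longlongrightarrow> 0) (at_right 0) \<and> \<Phi> t \<infinity> = \<infinity>"
    and meas [measurable]: "\<And>u. (\<lambda>t. \<Phi> t u) \<in> borel_measurable M"
    using assms(2) unfolding musielak_orlicz_def by blast+
  obtain N where N: "{t \<in> space M. \<not> (convex_enn (\<Phi> t) \<and> lower_semicont (\<Phi> t) \<and>
        \<Phi> t 0 = 0 \<and> (\<Phi> t \<longlongrightarrow> 0) (at_right 0) \<and> \<Phi> t \<infinity> = \<infinity>)} \<subseteq> N"
    "N \<in> null_sets M"
    using AE_E[OF good] by (metis (no_types, lifting) null_setsI)
  \<comment> \<open>The identity satisfies all the axioms and replaces \<open>\<Phi> t\<close> on
    the null set and outside \<open>space M\<close>.\<close>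
  define \<Psi> where "\<Psi> t = (if t \<in> space M - N then \<Phi> t else (\<lambda>u. u))" for t
  have [measurable]: "N \<in> sets M" using N(2) by auto
  have good': "convex_enn (\<Phi> t) \<and> lower_semicont (\<Phi> t) \<and>
        \<Phi> t 0 = 0 \<and> (\<Phi> t \<longlongrightarrow> 0) (at_right 0) \<and> \<Phi> t top = top" if "t \<in> space M - N" for t
    using that N(1) by auto
  have lsc_id: "lower_semicont (\<lambda>u::ennreal. u)"
    unfolding lower_semicont_def by (auto intro: order_tendstoD tendsto_ident_at eventually_nhds_in_open[of "{_<..}", simplified])
  have "regular_musielak_orlicz M \<Psi>"
  proof (intro regular_musielak_orlicz.intro regular_musielak_orlicz_axioms.intro assms(1))
    fix t
    show "convex_enn (\<Psi> t)" "lower_semicont (\<Psi> t)" "\<Psi> t 0 = 0" "(\<Psi> t \<longlongrightarrow> 0) (at_right 0)" "\<Psi> t top = top"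
      using good'[of t] lsc_id by (auto simp: \<Psi>_def convex_enn_def)
  next
    fix u
    have "(\<lambda>t. \<Psi> t u) = (\<lambda>t. if t \<in> space M - N then \<Phi> t u else u)" by (auto simp: \<Psi>_def)
    then show "(\<lambda>t. \<Psi> t u) \<in> borel_measurable M" by simp
  qed
  moreover have "AE t in M. \<Psi> t = \<Phi> t"
    by (rule AE_I'[OF N(2)]) (auto simp: \<Psi>_def)
  ultimately show thesis by (rule that)
qed

theorem proposition6:
  fixes M :: "'a measure"
    and \<Phi> :: "'a \<Rightarrow> ennreal \<Rightarrow> ennreal"
    and f :: "('a \<Rightarrow> real) \<Rightarrow> real"
  assumes "sigma_finite_measure M"
    and "nonatomic M"
    and "musielak_orlicz M \<Phi>"
    and "f \<in> orlicz_dual M \<Phi>"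
    and "purely_singular M \<Phi> f"
  shows "dual_norm0 M \<Phi> f = sup_quotient (orlicz_space M \<Phi>) f (Q_lux M \<Phi>)
       \<and> dual_norm M \<Phi> f = sup_quotient (orlicz_space M \<Phi>) f (Q_orl M \<Phi>)
       \<and> dual_norm0 M \<Phi> f = dual_norm M \<Phi> f
       \<and> dual_norm M \<Phi> f = (SUP u\<in>orlicz_class M \<Phi>. ennreal \<bar>f u\<bar>)
       \<and> (SUP u\<in>orlicz_class M \<Phi>. ennreal \<bar>f u\<bar>) = sup_quotient (orlicz_space M \<Phi>) f (theta M \<Phi>)"
proof -
  obtain \<Psi> where \<Psi>: "regular_musielak_orlicz M \<Psi>" "AE t in M. \<Psi> t = \<Phi> t"
    using regular_version[OF assms(1,3)] .
  \<comment> \<open>The integrand enters every notion only through its modular and that of its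
    complementary function. These are integrals, so they agree exactly for \<open>\<Psi>\<close> and
    \<open>\<Phi>\<close>, and all derived notions coincide.\<close>
  have mod: "modular M \<Psi> = modular M \<Phi>"
    using \<Psi>(2) by (auto simp: modular_def fun_eq_iff intro!: nn_integral_cong_AE elim!: eventually_mono)
  have mod_compl: "modular M (complementary \<Psi>) = modular M (complementary \<Phi>)"
    using \<Psi>(2) by (auto simp: modular_def complementary_def fun_eq_iff intro!: nn_integral_cong_AE elim!: eventually_mono)
  have space: "orlicz_space M \<Psi> = orlicz_space M \<Phi>" "orlicz_class M \<Psi> = orlicz_class M \<Phi>"
    by (simp_all add: orlicz_space_def orlicz_class_def mod)
  have lux: "luxemburg_norm M \<Psi> = luxemburg_norm M \<Phi>" and theta: "theta M \<Psi> = theta M \<Phi>"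
    by (simp_all add: luxemburg_norm_def theta_def mod fun_eq_iff)
  have orl: "orlicz_norm M \<Psi> = orlicz_norm M \<Phi>"
    by (simp add: orlicz_norm_def orlicz_class_def mod_compl fun_eq_iff)
  have Q: "Q_lux M \<Psi> = Q_lux M \<Phi>" "Q_orl M \<Psi> = Q_orl M \<Phi>"
    by (simp_all add: Q_lux_def Q_orl_def lux orl fun_eq_iff)
  have dual_norms: "dual_norm0 M \<Psi> f = dual_norm0 M \<Phi> f" "dual_norm M \<Psi> f = dual_norm M \<Phi> f"
    by (simp_all add: dual_norm0_def dual_norm_def nonzero_orlicz_def space lux orl)
  have "functional_pos M \<Psi> = functional_pos M \<Phi>"
    by (simp add: functional_pos_def space fun_eq_iff)
  then have "purely_singular M \<Psi> f"
    using assms(5) by (simp add: purely_singular_def oc_component_def functional_neg_def space)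
  moreover have "f \<in> orlicz_dual M \<Psi>"
    using assms(4) by (simp add: orlicz_dual_def space lux)
  ultimately interpret singular_functional M \<Psi> f
    using \<Psi>(1) by (intro singular_functional.intro orlicz_functional.intro
      orlicz_functional_axioms.intro singular_functional_axioms.intro)
  show ?thesis
    using singular_norms sup_orlicz_class_eq_sup_quotient_theta
    unfolding space theta Q dual_norms by simp
qed

end
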